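(* Let $d=2$ and let $\alpha_0,\alpha_1:\mathbb R^2\to U(m)$ be two families of matching matrices (same $\varepsilon$). Then $\alpha_0$ and $\alpha_1$ are equivariantly homotopic if and only if each of the four pairs of one-dimensional families of matching matrices $\{\alpha_0(0,k_2)\}_{k_2}$ and $\{\alpha_1(0,k_2)\}_{k_2}$; $\{\alpha_0(1/2,k_2)\}_{k_2}$ and $\{\alpha_1(1/2,k_2)\}_{k_2}$; $\{\alpha_0(k_1,0)\}_{k_1}$ and $\{\alpha_1(k_1,0)\}_{k_1}$; $\{\alpha_0(k_1,1/2)\}_{k_1}$ and $\{\alpha_1(k_1,1/2)\}_{k_1}$ is equivariantly homotopic (as families of matching matrices in dimension $d=1$).
   Context: Fix $m\ge1$; $\varepsilon$ is either the $m\times m$ identity $\mathbf 1$ (bosonic) or, for $m$ even, $J=\begin{pmatrix}0&\mathbf 1\\-\mathbf 1&0\end{pmatrix}$ (fermionic). A family of matching matrices in dimension $d$ is a continuous, $\mathbb Z^d$-periodic map $\alpha:\mathbb R^d\to U(m)$ with $\varepsilon\,\alpha(\mathbf k)=\alpha(-\mathbf k)^t\,\varepsilon$ for all $\mathbf k$. (The four restrictions listed are families of matching matrices in $d=1$ because $0$ and $1/2$ satisfy $x\equiv -x \bmod \mathbb Z$.) Two families $\alpha_0,\alpha_1$ are equivariantly homotopic if there is a map $(t,\mathbf k)\mapsto\alpha_t(\mathbf k)$, continuous in $t\in[0,1]$, with each $\alpha_t$ a family of matching matrices, $\alpha_{t=0}=\alpha_0$, $\alpha_{t=1}=\alpha_1$.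 *)

theory Defs
  imports "HOL-Analysis.Analysis"
begin

definition cadjoint :: "complex^'n^'n \<Rightarrow> complex^'n^'n" where
  "cadjoint A = (\<chi> i j. cnj (A $ j $ i))"

definition unitary_mat :: "complex^'n^'n \<Rightarrow> bool" where
  "unitary_mat A \<longleftrightarrow> A ** cadjoint A = mat 1 \<and> cadjoint A ** A = mat 1"

text \<open>Standard symplectic matrix J = [[0, 1],[-1, 0]] on indices 0..<m (m even),
  in block form with blocks of size m/2.\<close>
definition Jnat :: "nat \<Rightarrow> nat \<Rightarrow> nat \<Rightarrow> complex" where
  "Jnat m i j = (if i < m div 2 \<and> j = i + m div 2 then 1
                 else if m div 2 \<le> i \<and> i < m \<and> j + m div 2 = i then -1 else 0)"

text \<open>epsilon is the fermionic J, with respect to an enumeration e of the index type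
  by {0..<m} (the standard basis order).\<close>
definition is_J :: "complex^'n^'n \<Rightarrow> bool" where
  "is_J \<epsilon> \<longleftrightarrow> even CARD('n) \<and>
     (\<exists>e::'n \<Rightarrow> nat. bij_betw e UNIV {0..<CARD('n)} \<and>
        \<epsilon> = (\<chi> i j. Jnat CARD('n) (e i) (e j)))"

definition admissible_eps :: "complex^'n^'n \<Rightarrow> bool" where
  "admissible_eps \<epsilon> \<longleftrightarrow> \<epsilon> = mat 1 \<or> is_J \<epsilon>"

definition matching_family :: "complex^'n^'n \<Rightarrow> (real^'d \<Rightarrow> complex^'n^'n) \<Rightarrow> bool" where
  "matching_family \<epsilon> \<alpha> \<longleftrightarrow>
     continuous_on UNIV \<alpha> \<and>
     (\<forall>k. unitary_mat (\<alpha> k)) \<and>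
     (\<forall>k v. (\<forall>i. v $ i \<in> \<int>) \<longrightarrow> \<alpha> (k + v) = \<alpha> k) \<and>
     (\<forall>k. \<epsilon> ** \<alpha> k = transpose (\<alpha> (- k)) ** \<epsilon>)"

definition equiv_homotopic ::
  "complex^'n^'n \<Rightarrow> (real^'d \<Rightarrow> complex^'n^'n) \<Rightarrow> (real^'d \<Rightarrow> complex^'n^'n) \<Rightarrow> bool" where
  "equiv_homotopic \<epsilon> \<alpha>0 \<alpha>1 \<longleftrightarrow> homotopic_with_canon (matching_family \<epsilon>) UNIV UNIV \<alpha>0 \<alpha>1"

definition restr1 :: "(real^2 \<Rightarrow> 'b) \<Rightarrow> real \<Rightarrow> real^1 \<Rightarrow> 'b" where
  "restr1 \<alpha> c = (\<lambda>k. \<alpha> (vector [c, k $ 1]))"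

definition restr2 :: "(real^2 \<Rightarrow> 'b) \<Rightarrow> real \<Rightarrow> real^1 \<Rightarrow> 'b" where
  "restr2 \<alpha> c = (\<lambda>k. \<alpha> (vector [k $ 1, c]))"

end

theory Submission
  imports Defs
begin

text \<open>
  The determinant of a family of matching matrices is even and periodic, so it has an even and periodic
  argument, and the family lifts to the universal cover \<open>{(A, t). det A = cis t}\<close> of the unitary group, on
  which the involution \<open>A \<mapsto> \<epsilon>* A\<^sup>T \<epsilon>\<close> acts through the first component. Since the first and second homotopy
  groups of this cover vanish, an equivariant homotopy can be built cell by cell on half of the unit cell of
  the torus, as soon as the lifts at the four points \<open>k = -k\<close> of the torus are connected by paths inside the
  fixed set of the involution.

  A homotopy along one of the lines gives such paths at its two fixed points, after shifting one lift by a
  multiple of \<open>2 * pi\<close> that depends on the line. The shifts can be made equal because the matrices fixed by the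
  involution form a path connected set, so that the winding numbers of the determinant on its loops are the
  same at every base point.
\<close>

section \<open>Unitary matrices\<close>

lemma matrix_add_rdistrib: "(A + B) ** C = A ** C + B ** (C :: 'a::semiring_1^'n^'m)"
  by (vector matrix_matrix_mult_def sum.distrib[symmetric] distrib_right)

lemma matrix_diff_ldistrib: "A ** (B - C) = A ** B - A ** (C :: 'a::ring_1^'n^'m)"
  by (vector matrix_matrix_mult_def sum_subtractf[symmetric] right_diff_distrib)

lemma matrix_diff_rdistrib: "(A - B) ** C = A ** C - B ** (C :: 'a::ring_1^'n^'m)"
  by (vector matrix_matrix_mult_def sum_subtractf[symmetric] left_diff_distrib)

lemma mat_mult_nth: "(mat z ** A) $ i $ j = z * A $ i $ j"
  by (simp add: matrix_matrix_mult_def mat_def if_distrib [where f="\<lambda>x. x * y" for y] cong: if_cong)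

lemma mult_mat_nth: "(A ** mat z) $ i $ j = A $ i $ j * z"
  by (simp add: matrix_matrix_mult_def mat_def if_distrib [where f="\<lambda>x. y * x" for y] cong: if_cong)

lemma mat_mult_commute: "A ** mat z = mat z ** (A :: complex^'n^'n)"
  by (simp add: vec_eq_iff mat_mult_nth mult_mat_nth)

lemma mat_mult_mat: "mat a ** mat b = (mat (a * b) :: complex^'n^'n)"
  by (simp add: vec_eq_iff mat_mult_nth) (simp add: mat_def)

lemma mat_mult_vector: "mat z *v x = z *s (x :: complex^'n)"
  by (simp add: vec_eq_iff matrix_vector_mult_def mat_def if_distrib [where f="\<lambda>x. x * y" for y] cong: if_cong)

lemma continuous_on_matrix_mult [continuous_intros]:
  fixes f g :: "'a::topological_space \<Rightarrow> complex^'n^'n"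
  assumes "continuous_on S f" "continuous_on S g"
  shows "continuous_on S (\<lambda>x. f x ** g x)"
  unfolding matrix_matrix_mult_def
  by (intro continuous_on_vec_lambda continuous_intros assms)

lemma continuous_on_matrix_vector_mult [continuous_intros]:
  fixes f :: "'a::topological_space \<Rightarrow> complex^'n^'n"
  assumes "continuous_on S f" "continuous_on S g"
  shows "continuous_on S (\<lambda>x. f x *v g x)"
  unfolding matrix_vector_mult_def
  by (intro continuous_on_vec_lambda continuous_intros assms)

lemma continuous_on_transpose [continuous_intros]:
  fixes f :: "'a::topological_space \<Rightarrow> complex^'n^'n"
  assumes "continuous_on S f"
  shows "continuous_on S (\<lambda>x. transpose (f x))"
  unfolding transpose_def
  by (intro continuous_on_vec_lambda continuous_intros assms)

lemma continuous_on_cadjoint [continuous_intros]: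
  fixes f :: "'a::topological_space \<Rightarrow> complex^'n^'n"
  assumes "continuous_on S f"
  shows "continuous_on S (\<lambda>x. cadjoint (f x))"
  unfolding cadjoint_def
  by (intro continuous_on_vec_lambda continuous_intros assms)

lemma continuous_on_mat [continuous_intros]:
  fixes f :: "'a::topological_space \<Rightarrow> complex"
  assumes "continuous_on S f"
  shows "continuous_on S (\<lambda>x. mat (f x) :: complex^'n^'n)"
proof -
  have "continuous_on S (\<lambda>x. if i = j then f x else 0)" for i j :: 'n
    using assms by (cases "i = j") auto
  then show ?thesis
    unfolding mat_def by (intro continuous_on_vec_lambda)
qed

lemma continuous_on_det [continuous_intros]:
  fixes f :: "'a::topological_space \<Rightarrow> complex^'n^'n"
  assumes "continuous_on S f"
  shows "continuous_on S (\<lambda>x. det (f x))"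
  unfolding det_def
  by (intro continuous_intros assms)

lemma cadjoint_mult: "cadjoint (A ** B) = cadjoint B ** cadjoint A"
  by (simp add: vec_eq_iff cadjoint_def matrix_matrix_mult_def mult.commute)

lemma cadjoint_cadjoint [simp]: "cadjoint (cadjoint A) = A"
  by (simp add: vec_eq_iff cadjoint_def)

lemma cadjoint_mat [simp]: "cadjoint (mat z) = mat (cnj z)"
  by (auto simp: vec_eq_iff cadjoint_def mat_def)

lemma cadjoint_add: "cadjoint (A + B) = cadjoint A + cadjoint B"
  by (simp add: vec_eq_iff cadjoint_def)

lemma cadjoint_diff: "cadjoint (A - B) = cadjoint A - cadjoint B"
  by (simp add: vec_eq_iff cadjoint_def)

lemma det_cadjoint: "det (cadjoint A) = cnj (det A)"
proof -
  have "cadjoint A = transpose (\<chi> i j. cnj (A $ i $ j))"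
    by (simp add: vec_eq_iff cadjoint_def transpose_def)
  then have "det (cadjoint A) = det (\<chi> i j. cnj (A $ i $ j))"
    by simp
  then show ?thesis
    by (simp add: det_def)
qed

lemma unitary_matI: "A ** cadjoint A = mat 1 \<Longrightarrow> unitary_mat A"
  using matrix_left_right_inverse by (auto simp: unitary_mat_def)

lemma unitary_mat_one [simp]: "unitary_mat (mat 1)"
  by (simp add: unitary_mat_def)

lemma unitary_mat_mult:
  assumes "unitary_mat A" "unitary_mat B"
  shows "unitary_mat (A ** B)"
proof (rule unitary_matI)
  have "(A ** B) ** cadjoint (A ** B) = A ** (B ** cadjoint B) ** cadjoint A"
    by (simp add: cadjoint_mult matrix_mul_assoc)
  then show "(A ** B) ** cadjoint (A ** B) = mat 1"
    using assms by (simp add: unitary_mat_def)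
qed

lemma unitary_mat_cadjoint: "unitary_mat A \<Longrightarrow> unitary_mat (cadjoint A)"
  by (simp add: unitary_mat_def)

lemma unitary_mat_mat: "norm z = 1 \<Longrightarrow> unitary_mat (mat z)"
  by (simp add: unitary_mat_def mat_mult_mat complex_norm_square [symmetric] mult.commute)

lemma norm_det_unitary:
  assumes "unitary_mat A"
  shows "norm (det A) = 1"
proof -
  have "det A * cnj (det A) = 1"
    using assms by (metis det_I det_cadjoint det_mul unitary_mat_def)
  then have "(norm (det A))\<^sup>2 = 1"
    by (metis complex_norm_square of_real_eq_1_iff)
  then show ?thesis
    by (simp add: abs_square_eq_1)
qed

definition hdot :: "complex^'n \<Rightarrow> complex^'n \<Rightarrow> complex" where
  "hdot u v = (\<Sum>i\<in>UNIV. cnj (u $ i) * v $ i)"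

lemma hdot_add_left: "hdot (u + v) w = hdot u w + hdot v w"
  by (simp add: hdot_def sum.distrib distrib_right)

lemma hdot_add_right: "hdot w (u + v) = hdot w u + hdot w v"
  by (simp add: hdot_def sum.distrib distrib_left)

lemma hdot_scale_left: "hdot (c *s u) v = cnj c * hdot u v"
  by (simp add: hdot_def sum_distrib_left mult.assoc)

lemma hdot_scale_right: "hdot u (c *s v) = c * hdot u v"
  by (simp add: hdot_def sum_distrib_left mult.left_commute)

lemma cnj_hdot: "cnj (hdot u v) = hdot v u"
  by (simp add: hdot_def mult.commute)

lemma Re_hdot: "Re (hdot u v) = inner u v"
  by (simp add: hdot_def inner_vec_def inner_complex_def)

lemma hdot_self: "hdot u u = of_real ((norm u)\<^sup>2)"
proof (rule complex_eqI)
  show "Re (hdot u u) = Re (of_real ((norm u)\<^sup>2))"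
    by (simp add: Re_hdot power2_norm_eq_inner)
  have "Im (hdot u u) = - Im (hdot u u)"
    by (metis cnj_hdot cnj.simps(2))
  then show "Im (hdot u u) = Im (of_real ((norm u)\<^sup>2))"
    by simp
qed

lemma hdot_matrix: "hdot u (A *v v) = hdot (cadjoint A *v u) v"
proof -
  have "hdot u (A *v v) = (\<Sum>i\<in>UNIV. \<Sum>j\<in>UNIV. cnj (u $ i) * (A $ i $ j * v $ j))"
    by (simp add: hdot_def matrix_vector_mult_def sum_distrib_left)
  also have "\<dots> = (\<Sum>j\<in>UNIV. \<Sum>i\<in>UNIV. cnj (u $ i) * (A $ i $ j * v $ j))"
    by (rule sum.swap)
  also have "\<dots> = hdot (cadjoint A *v u) v"
    by (simp add: hdot_def matrix_vector_mult_def cadjoint_def sum_distrib_left mult_ac)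
  finally show ?thesis .
qed

lemma hdot_unitary: "unitary_mat A \<Longrightarrow> hdot (A *v u) (A *v v) = hdot u v"
  by (simp add: hdot_matrix matrix_vector_mul_assoc unitary_mat_def)

lemma norm_unitary:
  assumes "unitary_mat A"
  shows "norm (A *v u) = norm u"
proof -
  have "inner (A *v u) (A *v u) = inner u u"
    using hdot_unitary [OF assms, of u u] by (metis Re_hdot)
  then show ?thesis
    by (simp add: norm_eq_sqrt_inner)
qed

lemma continuous_on_hdot [continuous_intros]:
  assumes "continuous_on S f" "continuous_on S g"
  shows "continuous_on S (\<lambda>x. hdot (f x) (g x))"
  unfolding hdot_def by (intro continuous_intros assms)

definition outer_prod :: "complex^'n \<Rightarrow> complex^'n \<Rightarrow> complex^'n^'n" where
  "outer_prod u v = (\<chi> i j. u $ i * cnj (v $ j))"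

lemma outer_prod_vector: "outer_prod u v *v x = hdot v x *s u"
  by (simp add: vec_eq_iff outer_prod_def matrix_vector_mult_def hdot_def sum_distrib_left mult_ac)

lemma outer_prod_mult: "outer_prod u v ** outer_prod x y = mat (hdot v x) ** outer_prod u y"
  by (simp add: vec_eq_iff mat_mult_nth) (simp add: outer_prod_def matrix_matrix_mult_def hdot_def sum_distrib_left mult_ac)

lemma cadjoint_outer_prod: "cadjoint (outer_prod u v) = outer_prod v u"
  by (simp add: vec_eq_iff cadjoint_def outer_prod_def)

text \<open>A complex reflection: it fixes the orthogonal complement of \<open>w\<close> pointwise, and it is unitary when
  \<open>c + cnj c\<close> is the squared norm of \<open>w\<close>.\<close>
definition creflect :: "complex^'n \<Rightarrow> complex \<Rightarrow> complex^'n^'n" where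
  "creflect w c = mat 1 - mat (1 / c) ** outer_prod w w"

lemma creflect_vector: "creflect w c *v x = x - (hdot w x / c) *s w"
  by (simp add: creflect_def matrix_vector_mult_diff_rdistrib matrix_vector_mul_assoc [symmetric]
      outer_prod_vector mat_mult_vector vector_scalar_commute)

lemma unitary_creflect:
  assumes "c \<noteq> 0" "c + cnj c = hdot w w"
  shows "unitary_mat (creflect w c)"
proof (rule unitary_matI)
  let ?P = "outer_prod w w"
  have ad: "cadjoint (creflect w c) = mat 1 - mat (1 / cnj c) ** ?P"
    by (simp add: creflect_def cadjoint_diff cadjoint_mult cadjoint_outer_prod mat_mult_commute)
  have "1 / c + 1 / cnj c = hdot w w / (c * cnj c)"
    using assms by (simp add: field_simps)
  then have *: "1 / c * x + 1 / cnj c * x = hdot w w / (c * cnj c) * x" for x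
    by (metis distrib_right)
  have "(mat (1 / c) ** ?P) ** (mat (1 / cnj c) ** ?P) = mat (1 / c) ** (?P ** mat (1 / cnj c)) ** ?P"
    by (simp add: matrix_mul_assoc)
  also have "\<dots> = mat (1 / c) ** (mat (1 / cnj c) ** ?P) ** ?P"
    by (simp only: mat_mult_commute)
  also have "\<dots> = (mat (1 / c) ** mat (1 / cnj c)) ** (?P ** ?P)"
    by (simp only: matrix_mul_assoc)
  also have "\<dots> = mat (hdot w w / (c * cnj c)) ** ?P"
    by (simp add: outer_prod_mult mat_mult_mat matrix_mul_assoc)
  finally show "creflect w c ** cadjoint (creflect w c) = mat 1"
    unfolding ad unfolding creflect_def
    using * by (simp add: matrix_diff_ldistrib matrix_diff_rdistrib vec_eq_iff mat_mult_nth algebra_simps)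
qed

definition rotate_to :: "complex^'n \<Rightarrow> complex^'n \<Rightarrow> complex^'n^'n" where
  "rotate_to u v = creflect v (1/2) ** creflect (u + v) (1 + hdot v u)"

lemma one_plus_hdot_nz:
  assumes "norm u = 1" "norm v = 1" "u \<noteq> - v"
  shows "1 + hdot v u \<noteq> 0"
proof
  assume "1 + hdot v u = 0"
  then have "Re (1 + hdot v u) = 0"
    by simp
  then have "inner v u = -1"
    by (simp add: Re_hdot)
  moreover have "inner u u = 1" "inner v v = 1"
    using assms by (simp_all add: dot_square_norm)
  moreover have "inner (u + v) (u + v) = inner u u + inner v v + 2 * inner v u"
    by (simp only: inner_add_left inner_add_right inner_commute [of u v])
  ultimately have "inner (u + v) (u + v) = 0"
    by simp
  then show False
    using assms by (simp add: eq_neg_iff_add_eq_0)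
qed

lemma unitary_rotate_to:
  assumes "norm u = 1" "norm v = 1" "u \<noteq> - v"
  shows "unitary_mat (rotate_to u v)"
  unfolding rotate_to_def
proof (intro unitary_mat_mult unitary_creflect)
  show "1 + hdot v u \<noteq> 0"
    using assms by (rule one_plus_hdot_nz)
  show "1 + hdot v u + cnj (1 + hdot v u) = hdot (u + v) (u + v)"
    using assms by (simp add: cnj_hdot hdot_add_left hdot_add_right) (simp add: hdot_self)
qed (use assms in \<open>auto simp: hdot_self\<close>)

lemma rotate_to_vector:
  assumes "norm u = 1" "norm v = 1" "u \<noteq> - v"
  shows "rotate_to u v *v u = v"
proof -
  have "creflect (u + v) (1 + hdot v u) *v u = - v"
    using assms one_plus_hdot_nz [OF assms]
    by (simp add: creflect_vector hdot_add_left hdot_self)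
  then show ?thesis
    using assms
    by (simp add: rotate_to_def matrix_vector_mul_assoc [symmetric] creflect_vector)
       (simp add: vec_eq_iff hdot_def sum_negf, simp add: hdot_def [symmetric] hdot_self)
qed

lemma continuous_on_outer_prod [continuous_intros]:
  assumes "continuous_on S f" "continuous_on S g"
  shows "continuous_on S (\<lambda>x. outer_prod (f x) (g x))"
  unfolding outer_prod_def by (intro continuous_on_vec_lambda continuous_intros assms)

lemma continuous_on_rotate_to:
  assumes "continuous_on S f" "continuous_on S g"
    and "\<And>x. x \<in> S \<Longrightarrow> norm (f x) = 1" "\<And>x. x \<in> S \<Longrightarrow> norm (g x) = 1" "\<And>x. x \<in> S \<Longrightarrow> f x \<noteq> - g x"
  shows "continuous_on S (\<lambda>x. rotate_to (f x) (g x))"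
  unfolding rotate_to_def creflect_def
  using assms(1,2)
  by (intro continuous_intros) (auto simp: one_plus_hdot_nz assms(3-5))

definition supported_in :: "'n set \<Rightarrow> complex^'n^'n \<Rightarrow> bool" where
  "supported_in J A \<longleftrightarrow> (\<forall>i j. i \<notin> J \<or> j \<notin> J \<longrightarrow> A $ i $ j = mat 1 $ i $ j)"

lemma supported_in_mult:
  assumes "supported_in J A" "supported_in J B"
  shows "supported_in J (A ** B)"
  unfolding supported_in_def
proof (intro allI impI, elim disjE)
  fix i j
  assume "i \<notin> J"
  then have "(A ** B) $ i $ j = (mat 1 ** B) $ i $ j"
    using assms(1) by (simp add: supported_in_def matrix_matrix_mult_def del: matrix_mul_lid)
  then show "(A ** B) $ i $ j = mat 1 $ i $ j"
    using assms(2) \<open>i \<notin> J\<close> by (simp add: supported_in_def)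
next
  fix i j
  assume "j \<notin> J"
  then have "(A ** B) $ i $ j = (A ** mat 1) $ i $ j"
    using assms(2) by (simp add: supported_in_def matrix_matrix_mult_def del: matrix_mul_rid)
  then show "(A ** B) $ i $ j = mat 1 $ i $ j"
    using assms(1) \<open>j \<notin> J\<close> by (simp add: supported_in_def)
qed

lemma supported_in_cadjoint: "supported_in J A \<Longrightarrow> supported_in J (cadjoint A)"
  by (auto simp: supported_in_def cadjoint_def mat_def)

lemma supported_in_creflect:
  assumes "\<And>i. i \<notin> J \<Longrightarrow> w $ i = 0"
  shows "supported_in J (creflect w c)"
  using assms by (auto simp: supported_in_def creflect_def mat_mult_nth outer_prod_def)

lemma supported_in_rotate_to:
  assumes "\<And>i. i \<notin> J \<Longrightarrow> u $ i = 0" "\<And>i. i \<notin> J \<Longrightarrow> v $ i = 0"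
  shows "supported_in J (rotate_to u v)"
  unfolding rotate_to_def using assms
  by (intro supported_in_mult supported_in_creflect) auto

lemma supported_in_fix_axis:
  assumes "supported_in (insert a J) A" "unitary_mat A" "A *v axis a 1 = axis a 1"
  shows "supported_in J A"
  unfolding supported_in_def
proof (intro allI impI)
  fix i j
  assume ij: "i \<notin> J \<or> j \<notin> J"
  have col: "A $ k $ a = mat 1 $ k $ a" for k
    using arg_cong [OF assms(3), of "\<lambda>v. v $ k"]
    by (simp add: matrix_vector_mult_def axis_def mat_def if_distrib cong: if_cong)
  have "cadjoint A *v axis a 1 = cadjoint A *v (A *v axis a 1)"
    by (simp add: assms(3))
  also have "\<dots> = axis a 1"
    using assms(2) by (simp only: matrix_vector_mul_assoc) (simp add: unitary_mat_def)
  finally have ad: "cadjoint A *v axis a 1 = axis a 1" .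
  have row: "A $ a $ k = mat 1 $ a $ k" for k
  proof -
    have "cnj (A $ a $ k) = (cadjoint A *v axis a 1) $ k"
      by (simp add: cadjoint_def matrix_vector_mult_def axis_def if_distrib cong: if_cong)
    also have "\<dots> = (if k = a then 1 else 0)"
      unfolding ad by (simp add: axis_def)
    finally have "cnj (cnj (A $ a $ k)) = cnj (if k = a then 1 else 0)"
      by simp
    then show ?thesis
      by (auto simp: mat_def)
  qed
  show "A $ i $ j = mat 1 $ i $ j"
    using ij col row assms(1) by (metis insertE supported_in_def)
qed

section \<open>Extension of maps into the universal cover of the unitary group\<close>

lemma cis_lift:
  fixes f :: "'a::real_normed_vector \<Rightarrow> complex"
  assumes "continuous_on S f" "convex S" "\<And>x. x \<in> S \<Longrightarrow> norm (f x) = 1"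
  obtains \<theta> where "continuous_on S \<theta>" "\<And>x. x \<in> S \<Longrightarrow> f x = cis (\<theta> x)"
proof -
  have "f x \<noteq> 0" if "x \<in> S" for x
    using assms(3) [OF that] by auto
  then obtain g where g: "continuous_on S g" "\<And>x. x \<in> S \<Longrightarrow> f x = exp (g x)"
    using continuous_logarithm_on_contractible [OF assms(1) convex_imp_contractible [OF assms(2)]] by metis
  show ?thesis
  proof
    show "continuous_on S (\<lambda>x. Im (g x))"
      by (intro continuous_intros g)
    fix x assume x: "x \<in> S"
    then have "exp (Re (g x)) = 1"
      using g(2) assms(3) by (metis norm_exp_eq_Re)
    then show "f x = cis (Im (g x))"
      using g(2) [OF x] by (simp add: exp_eq_polar)
  qed
qed

lemma unitary_lift_of_sphere_map:
  fixes g :: "'a::euclidean_space \<Rightarrow> complex^'n"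
  assumes C: "compact C" "convex C" "k \<in> C" and g: "continuous_on C g"
    and norm: "\<And>x. x \<in> C \<Longrightarrow> norm (g x) = 1"
    and supp: "\<And>x i. x \<in> C \<Longrightarrow> i \<notin> J \<Longrightarrow> g x $ i = 0"
  obtains G where "continuous_on C G"
    "\<And>x. x \<in> C \<Longrightarrow> unitary_mat (G x) \<and> supported_in J (G x) \<and> G x *v g k = g x"
proof -
  have "uniformly_continuous_on C g"
    using C g compact_uniformly_continuous by blast
  then obtain \<delta> where \<delta>: "\<delta> > 0"
    "\<And>x y. x \<in> C \<Longrightarrow> y \<in> C \<Longrightarrow> dist y x < \<delta> \<Longrightarrow> dist (g y) (g x) < 2"
    unfolding uniformly_continuous_on_def by (metis zero_less_numeral)
  obtain B where B: "\<And>x. x \<in> C \<Longrightarrow> norm (x - k) \<le> B"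
    using C(1) compact_imp_bounded [of C] bounded_def [of C] C(3) by (metis dist_commute dist_norm bounded_any_center)
  have "B \<ge> 0"
    using B [OF C(3)] by simp
  obtain N where N: "N > 0" "B / real N < \<delta>"
  proof -
    obtain n :: nat where n: "B / \<delta> < real n"
      using reals_Archimedean2 by blast
    then have "n > 0"
      using \<open>B \<ge> 0\<close> \<delta>(1) by (metis divide_nonneg_pos gr0I not_less of_nat_0)
    then show ?thesis
      using that [of n] n \<delta>(1) by (simp add: field_simps)
  qed
  define p where "p n x = k + (real n / real N) *\<^sub>R (x - k)" for n x
  have pC: "p n x \<in> C" if "n \<le> N" "x \<in> C" for n x
  proof -
    have "p n x = (1 - real n / real N) *\<^sub>R k + (real n / real N) *\<^sub>R x"
      by (simp add: p_def algebra_simps)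
    then show ?thesis
      using C(2,3) that N(1) by (simp add: convexD)
  qed
  have contp: "continuous_on C (p n)" for n
    unfolding p_def by (intro continuous_intros)
  have contgp: "continuous_on C (\<lambda>x. g (p n x))" if "n \<le> N" for n
    using continuous_on_compose2 [OF g contp [of n]] pC [OF that] by blast
  have anti: "g (p n x) \<noteq> - g (p (Suc n) x)" if "Suc n \<le> N" "x \<in> C" for n x
  proof
    assume eq: "g (p n x) = - g (p (Suc n) x)"
    have in_C: "p n x \<in> C" "p (Suc n) x \<in> C"
      using pC that by auto
    have "p (Suc n) x - p n x = (1 / real N) *\<^sub>R (x - k)"
      by (simp add: p_def add_divide_distrib algebra_simps)
    then have "dist (p (Suc n) x) (p n x) = norm (x - k) / real N"
      by (simp add: dist_norm)
    also have "\<dots> \<le> B / real N"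
      using B [OF that(2)] by (simp add: divide_right_mono)
    finally have "dist (g (p (Suc n) x)) (g (p n x)) < 2"
      using \<delta>(2) [OF in_C] N(2) by linarith
    moreover have "dist (g (p (Suc n) x)) (g (p n x)) = norm (2 *\<^sub>R g (p (Suc n) x))"
      by (simp add: dist_norm eq scaleR_2)
    ultimately show False
      using norm [OF in_C(2)] by simp
  qed
  have "\<exists>G. continuous_on C G \<and>
      (\<forall>x\<in>C. unitary_mat (G x) \<and> supported_in J (G x) \<and> G x *v g k = g (p n x))" if "n \<le> N" for n
    using that
  proof (induction n)
    case 0
    have "supported_in J (mat 1)"
      by (simp add: supported_in_def)
    then show ?case
      by (intro exI [of _ "\<lambda>x. mat 1"]) (auto simp: p_def)
  next
    case (Suc n)
    then obtain G where G: "continuous_on C G"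
      "\<And>x. x \<in> C \<Longrightarrow> unitary_mat (G x) \<and> supported_in J (G x) \<and> G x *v g k = g (p n x)"
      by auto
    have in_C: "p n x \<in> C" "p (Suc n) x \<in> C" if "x \<in> C" for x
      using pC that Suc.prems by auto
    let ?R = "\<lambda>x. rotate_to (g (p n x)) (g (p (Suc n) x))"
    have "continuous_on C (\<lambda>x. ?R x ** G x)"
      using contgp Suc.prems anti in_C norm
      by (intro continuous_intros continuous_on_rotate_to G) auto
    moreover have "unitary_mat (?R x ** G x) \<and> supported_in J (?R x ** G x)
        \<and> (?R x ** G x) *v g k = g (p (Suc n) x)" if "x \<in> C" for x
      using G(2) [OF that] in_C [OF that] anti [OF Suc.prems that] norm supp
      by (auto simp: matrix_vector_mul_assoc [symmetric] rotate_to_vector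
          intro!: unitary_mat_mult supported_in_mult supported_in_rotate_to unitary_rotate_to)
    ultimately show ?case
      by blast
  qed
  from this [of N] obtain G where "continuous_on C G"
      "\<And>x. x \<in> C \<Longrightarrow> unitary_mat (G x) \<and> supported_in J (G x) \<and> G x *v g k = g (p N x)"
    by auto
  moreover have "p N x = x" for x
    using N(1) by (simp add: p_def)
  ultimately show ?thesis
    using that by auto
qed

lemma extend_to_coordinate_sphere:
  fixes f :: "'a::euclidean_space \<Rightarrow> complex^'n"
  assumes C: "polytope C" "aff_dim C \<le> 3" and S: "closed S" "S \<subseteq> C"
    and ab: "a \<in> J" "b \<in> J" "a \<noteq> b"
    and f: "continuous_on S f" "\<And>x. x \<in> S \<Longrightarrow> norm (f x) = 1"
      "\<And>x i. x \<in> S \<Longrightarrow> i \<notin> J \<Longrightarrow> f x $ i = 0"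
  obtains g where "continuous_on C g" "\<And>x. x \<in> C \<Longrightarrow> norm (g x) = 1"
      "\<And>x i. x \<in> C \<Longrightarrow> i \<notin> J \<Longrightarrow> g x $ i = 0" "\<And>x. x \<in> S \<Longrightarrow> g x = f x"
proof -
  define V where "V = {v :: complex^'n. \<forall>i. i \<notin> J \<longrightarrow> v $ i = 0}"
  define T where "T = cball 0 1 \<inter> V"
  have V: "subspace V"
    by (auto simp: V_def subspace_def)
  have "0 \<in> V"
    using V by (rule subspace_0)
  then have "0 \<in> interior (cball 0 1) \<inter> V"
    by simp
  then have int: "interior (cball 0 1) \<inter> V \<noteq> {}"
    by blast
  have "rel_frontier T = frontier (cball 0 1) \<inter> V"
    unfolding T_def using V int by (intro convex_affine_rel_frontier_Int) (auto simp: subspace_imp_affine)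
  then have rf: "rel_frontier T = sphere 0 1 \<inter> V"
    by simp
  have "affine hull T = affine hull V"
    unfolding T_def Int_commute [of _ V] using V int
    by (intro affine_hull_convex_Int_nonempty_interior) (auto simp: subspace_imp_convex)
  then have "aff_dim T = aff_dim V"
    by (metis aff_dim_affine_hull)
  also have "\<dots> = int (dim V)"
    by (simp add: aff_dim_subspace V)
  finally have adT: "aff_dim T = int (dim V)" .
  let ?B = "{axis a 1, axis a \<i>, axis b 1, axis b \<i>} :: (complex^'n) set"
  have B4: "card ?B = 4"
    using ab(3) by (simp add: axis_eq_axis)
  have "?B \<subseteq> Basis"
    by (auto simp: axis_in_Basis_iff Basis_complex_def)
  then have "independent ?B"
    using independent_Basis independent_mono by blast
  moreover have "?B \<subseteq> V"
    using ab by (auto simp: V_def axis_def)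
  ultimately have "4 \<le> dim V"
    using independent_card_le_dim B4 by metis
  then have ad: "aff_dim C < aff_dim T"
    using C(2) adT by linarith
  have fim: "f \<in> S \<rightarrow> rel_frontier T"
    using f(2,3) by (auto simp: rf V_def)
  obtain g where "continuous_on (\<Union>{C}) g" "g \<in> (\<Union>{C}) \<rightarrow> rel_frontier T" "\<And>x. x \<in> S \<Longrightarrow> g x = f x"
  proof (rule extend_map_cell_complex_to_sphere [of "{C}" S T f])
    show "convex T" "bounded T"
      using V by (auto simp: T_def convex_Int subspace_imp_convex intro: bounded_Int)
    show "\<And>X Y. \<lbrakk>X \<in> {C}; Y \<in> {C}\<rbrakk> \<Longrightarrow> X \<inter> Y face_of X"
      using C by (simp add: face_of_refl polytope_imp_convex)
  qed (use C S ad f(1) fim in auto)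
  then show ?thesis
    using that [of g] by (auto simp: rf V_def Pi_iff)
qed

lemma column_norm:
  assumes "unitary_mat A"
  shows "norm (A *v axis a 1) = 1"
  using norm_unitary [OF assms, of "axis a 1"] by (simp add: norm_eq_sqrt_inner inner_axis_axis)

lemma unitary_diagonal:
  assumes "\<And>i. norm (d i) = 1"
  shows "unitary_mat (\<chi> i j. if i = j then d i else 0)"
proof (rule unitary_matI)
  have "(\<Sum>k\<in>UNIV. (if i = k then d i else 0) * cnj (if j = k then d j else 0)) = (if i = j then 1 else 0)"
    for i j :: 'a
  proof -
    have "(\<Sum>k\<in>UNIV. (if i = k then d i else 0) * cnj (if j = k then d j else 0))
        = (\<Sum>k\<in>UNIV. if i = k then d i * cnj (if j = i then d j else 0) else 0)"
      by (rule sum.cong) auto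
    also have "\<dots> = d i * cnj (if j = i then d j else 0)"
      by simp
    also have "\<dots> = (if i = j then 1 else 0)"
      using assms by (auto simp: complex_norm_square [symmetric])
    finally show ?thesis .
  qed
  then show "(\<chi> i j. if i = j then d i else 0) ** cadjoint (\<chi> i j. if i = j then d i else 0) = mat 1"
    by (simp add: vec_eq_iff matrix_matrix_mult_def cadjoint_def mat_def)
qed

text \<open>Induction on the size of \<open>J\<close>: the column of index \<open>a\<close> is a map into a sphere of dimension at least 3, hence
  extends to \<open>C\<close>, and so does its lift to unitary matrices; dividing by the lift leaves matrices that fix the
  basis vector of index \<open>a\<close>.\<close>
lemma unitary_extension:
  fixes f :: "'a::euclidean_space \<Rightarrow> complex^'n^'n"
  assumes C: "polytope C" "aff_dim C \<le> 3" and S: "closed S" "S \<subseteq> C"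
    and J: "finite J" "J \<noteq> {}"
    and "continuous_on S f" "continuous_on S \<theta>"
    and "\<And>x. x \<in> S \<Longrightarrow> unitary_mat (f x) \<and> supported_in J (f x) \<and> det (f x) = cis (\<theta> x)"
  shows "\<exists>g \<phi>. continuous_on C g \<and> continuous_on C \<phi> \<and>
      (\<forall>x\<in>C. unitary_mat (g x) \<and> det (g x) = cis (\<phi> x)) \<and> (\<forall>x\<in>S. g x = f x \<and> \<phi> x = \<theta> x)"
  using J assms(7-)
proof (induction J arbitrary: f \<theta> rule: finite_ne_induct)
  case (singleton a)
  obtain \<phi> where \<phi>: "continuous_on C \<phi>" "\<And>x. x \<in> S \<Longrightarrow> \<phi> x = \<theta> x"
    using Tietze_unbounded [OF singleton.prems(2), of C] S by (metis closed_subset)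
  define D where "D z = (\<chi> i j. if i = j then if i = a then z else 1 else 0)" for z :: complex
  have detD: "det (D z) = z" for z :: complex
    by (subst det_diagonal) (auto simp: D_def)
  have uD: "unitary_mat (D (cis t))" for t
    unfolding D_def by (rule unitary_diagonal) auto
  have fD: "f x = D (cis (\<phi> x))" if "x \<in> S" for x
  proof -
    have "f x = D (f x $ a $ a)"
      using singleton.prems(3) [OF that] by (auto simp: vec_eq_iff supported_in_def D_def mat_def)
    then show ?thesis
      using singleton.prems(3) [OF that] detD \<phi>(2) [OF that] by metis
  qed
  have "continuous_on C (\<lambda>x. D (cis (\<phi> x)))"
  proof -
    have "continuous_on C (\<lambda>x. if i = j then if i = a then cis (\<phi> x) else 1 else 0)" for i j :: 'n
      by (cases "i = j"; cases "i = a") (auto intro!: continuous_intros \<phi>(1))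
    then show ?thesis
      unfolding D_def by (intro continuous_on_vec_lambda)
  qed
  then show ?case
    using \<phi> uD detD fD by (intro exI [of _ "\<lambda>x. D (cis (\<phi> x))"] exI [of _ \<phi>]) auto
next
  case (insert a J)
  show ?case
  proof (cases "S = {}")
    case True
    then show ?thesis
      by (intro exI [of _ "\<lambda>x. mat 1"] exI [of _ "\<lambda>x. 0"]) auto
  next
    case False
    then obtain k where k: "k \<in> S"
      by blast
    obtain b where b: "b \<in> J"
      using insert by blast
    have comp: "compact C" "convex C"
      using C polytope_imp_compact polytope_imp_convex by auto
    let ?col = "\<lambda>x. f x *v axis a 1"
    have contcol: "continuous_on S ?col"
      by (intro continuous_intros insert.prems)
    have col_nth: "?col x $ i = f x $ i $ a" for x i
      by (simp add: matrix_vector_mult_def axis_def if_distrib cong: if_cong)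
    obtain g where g: "continuous_on C g" "\<And>x. x \<in> C \<Longrightarrow> norm (g x) = 1"
      "\<And>x i. x \<in> C \<Longrightarrow> i \<notin> insert a J \<Longrightarrow> g x $ i = 0" "\<And>x. x \<in> S \<Longrightarrow> g x = ?col x"
    proof (rule extend_to_coordinate_sphere [OF C S _ _ _ contcol, of a "insert a J" b])
      show "a \<noteq> b"
        using b insert by blast
      show "norm (?col x) = 1" if "x \<in> S" for x
        using insert.prems(3) [OF that] column_norm by blast
      show "?col x $ i = 0" if "x \<in> S" "i \<notin> insert a J" for x i
        using insert.prems(3) [OF that(1)] that(2) by (auto simp: col_nth supported_in_def mat_def)
    qed (use b in auto)
    obtain G where G: "continuous_on C G"
      "\<And>x. x \<in> C \<Longrightarrow> unitary_mat (G x) \<and> supported_in (insert a J) (G x) \<and> G x *v g k = g x"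
      using unitary_lift_of_sphere_map [OF comp _ g(1-3), of k] k S by blast
    define H where "H x = G x ** f k" for x
    have contH: "continuous_on C H"
      unfolding H_def by (intro continuous_intros G(1))
    have H: "unitary_mat (H x) \<and> supported_in (insert a J) (H x) \<and> H x *v axis a 1 = g x" if "x \<in> C" for x
      using G(2) [OF that] insert.prems(3) [OF k] g(4) [OF k]
      by (auto simp: H_def matrix_vector_mul_assoc [symmetric] intro: unitary_mat_mult supported_in_mult)
    obtain \<psi> where \<psi>: "continuous_on C \<psi>" "\<And>x. x \<in> C \<Longrightarrow> det (H x) = cis (\<psi> x)"
      using cis_lift [of C "\<lambda>x. det (H x)"] contH H norm_det_unitary comp(2) continuous_on_det by metis
    let ?f = "\<lambda>x. cadjoint (H x) ** f x"
    have "\<exists>g' \<phi>'. continuous_on C g' \<and> continuous_on C \<phi>' \<and>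
      (\<forall>x\<in>C. unitary_mat (g' x) \<and> det (g' x) = cis (\<phi>' x)) \<and>
      (\<forall>x\<in>S. g' x = ?f x \<and> \<phi>' x = \<theta> x - \<psi> x)"
    proof (rule insert.IH)
      show "continuous_on S ?f"
        using S(2) by (intro continuous_intros insert.prems continuous_on_subset [OF contH])
      show "continuous_on S (\<lambda>x. \<theta> x - \<psi> x)"
        using S(2) by (intro continuous_intros insert.prems continuous_on_subset [OF \<psi>(1)])
      fix x assume x: "x \<in> S"
      then have xC: "x \<in> C"
        using S by blast
      have u: "unitary_mat (?f x)"
        using H [OF xC] insert.prems(3) [OF x] by (auto intro: unitary_mat_mult unitary_mat_cadjoint)
      have "?f x *v axis a 1 = cadjoint (H x) *v (H x *v axis a 1)"
        using H [OF xC] g(4) [OF x] by (simp add: matrix_vector_mul_assoc [symmetric])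
      also have "\<dots> = axis a 1"
        using H [OF xC] unfolding matrix_vector_mul_assoc by (simp add: unitary_mat_def)
      finally have "supported_in J (?f x)"
        using H [OF xC] insert.prems(3) [OF x] u
        by (intro supported_in_fix_axis [of a J]) (auto intro: supported_in_mult supported_in_cadjoint)
      moreover have "det (?f x) = cis (\<theta> x - \<psi> x)"
        using \<psi>(2) [OF xC] insert.prems(3) [OF x]
        by (simp add: det_mul det_cadjoint cis_cnj cis_mult)
      ultimately show "unitary_mat (?f x) \<and> supported_in J (?f x) \<and> det (?f x) = cis (\<theta> x - \<psi> x)"
        using u by blast
    qed
    then obtain g' \<phi>' where g': "continuous_on C g'" "continuous_on C \<phi>'"
      "\<And>x. x \<in> C \<Longrightarrow> unitary_mat (g' x) \<and> det (g' x) = cis (\<phi>' x)"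
      "\<And>x. x \<in> S \<Longrightarrow> g' x = ?f x \<and> \<phi>' x = \<theta> x - \<psi> x"
      by blast
    have "H x ** ?f x = f x" if "x \<in> S" for x
    proof -
      have "H x ** cadjoint (H x) = mat 1"
        using H S that unitary_mat_def by blast
      then show ?thesis
        by (simp add: matrix_mul_assoc)
    qed
    then show ?thesis
      using g' H \<psi> S
      by (intro exI [of _ "\<lambda>x. H x ** g' x"] exI [of _ "\<lambda>x. \<psi> x + \<phi>' x"])
        (auto intro!: continuous_intros contH unitary_mat_mult simp: det_mul cis_mult)
  qed
qed

definition ucover :: "((complex^'n^'n) \<times> real) set" where
  "ucover = {(A, t). unitary_mat A \<and> det A = cis t}"

lemma ucover_extension:
  fixes f :: "'a::euclidean_space \<Rightarrow> (complex^'n^'n) \<times> real"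
  assumes C: "polytope C" "aff_dim C \<le> 3" and S: "closed S" "S \<subseteq> C"
    and f: "continuous_on S f" "f ` S \<subseteq> ucover"
  obtains g where "continuous_on C g" "g ` C \<subseteq> ucover" "\<And>x. x \<in> S \<Longrightarrow> g x = f x"
proof -
  have "unitary_mat (fst (f x)) \<and> supported_in UNIV (fst (f x)) \<and> det (fst (f x)) = cis (snd (f x))"
    if "x \<in> S" for x
    using f(2) that by (force simp: ucover_def supported_in_def)
  with unitary_extension [OF C S, of UNIV "fst \<circ> f" "snd \<circ> f"] f(1)
  obtain g \<phi> where "continuous_on C g" "continuous_on C \<phi>"
      "\<And>x. x \<in> C \<Longrightarrow> unitary_mat (g x) \<and> det (g x) = cis (\<phi> x)"
      "\<And>x. x \<in> S \<Longrightarrow> g x = fst (f x) \<and> \<phi> x = snd (f x)"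
    by (auto simp: o_def continuous_on_fst continuous_on_snd)
  then show ?thesis
    using that [of "\<lambda>x. (g x, \<phi> x)"] by (auto simp: ucover_def intro!: continuous_intros)
qed

section \<open>Equivariant homotopies on the torus\<close>

lemma paste_closed:
  assumes "closed S" "closed T" "continuous_on S f" "continuous_on T g"
    and "\<And>x. x \<in> S \<Longrightarrow> x \<in> T \<Longrightarrow> f x = g x"
  obtains h where "continuous_on (S \<union> T) h" "\<And>x. x \<in> S \<Longrightarrow> h x = f x" "\<And>x. x \<in> T \<Longrightarrow> h x = g x"
proof
  show "continuous_on (S \<union> T) (\<lambda>x. if x \<in> S then f x else g x)"
    using assms by (intro continuous_on_cases) auto
qed (use assms in auto)

lemma ucover_fill_square:
  fixes e0 e1 c0 c1 :: "real \<Rightarrow> (complex^'n^'n) \<times> real"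
  assumes "r > 0" "continuous_on {0..r} e0" "continuous_on {0..r} e1"
    and "continuous_on {0..1} c0" "continuous_on {0..1} c1"
    and "e0 ` {0..r} \<subseteq> ucover" "e1 ` {0..r} \<subseteq> ucover" "c0 ` {0..1} \<subseteq> ucover" "c1 ` {0..1} \<subseteq> ucover"
    and "c0 0 = e0 0" "c0 1 = e1 0" "c1 0 = e0 r" "c1 1 = e1 r"
  obtains E where "continuous_on ({0..1} \<times> {0..r}) E" "E ` ({0..1} \<times> {0..r}) \<subseteq> ucover"
    "\<And>s. s \<in> {0..r} \<Longrightarrow> E (0, s) = e0 s" "\<And>s. s \<in> {0..r} \<Longrightarrow> E (1, s) = e1 s"
    "\<And>t. t \<in> {0..1} \<Longrightarrow> E (t, 0) = c0 t" "\<And>t. t \<in> {0..1} \<Longrightarrow> E (t, r) = c1 t"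
proof -
  have cont_snd: "continuous_on (A \<times> {0..r}) (\<lambda>p. e (snd p))" if "continuous_on {0..r} e"
    for A :: "real set" and e :: "real \<Rightarrow> (complex^'n^'n) \<times> real"
    using that by (rule continuous_on_compose2) (auto intro: continuous_intros)
  have cont_fst: "continuous_on ({0..1} \<times> A) (\<lambda>p. c (fst p))" if "continuous_on {0..1} c"
    for A :: "real set" and c :: "real \<Rightarrow> (complex^'n^'n) \<times> real"
    using that by (rule continuous_on_compose2) (auto intro: continuous_intros)
  let ?V0 = "{0::real} \<times> {0..r}" and ?V1 = "{1::real} \<times> {0..r}"
  let ?H0 = "{0..1::real} \<times> {0::real}" and ?H1 = "{0..1::real} \<times> {r}"
  obtain v where v: "continuous_on (?V0 \<union> ?V1) v"
    "\<And>p. p \<in> ?V0 \<Longrightarrow> v p = e0 (snd p)" "\<And>p. p \<in> ?V1 \<Longrightarrow> v p = e1 (snd p)"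
    by (rule paste_closed [of ?V0 ?V1 "\<lambda>p. e0 (snd p)" "\<lambda>p. e1 (snd p)"])
      (use assms cont_snd in \<open>auto intro: closed_Times\<close>)
  obtain h where h: "continuous_on (?H0 \<union> ?H1) h"
    "\<And>p. p \<in> ?H0 \<Longrightarrow> h p = c0 (fst p)" "\<And>p. p \<in> ?H1 \<Longrightarrow> h p = c1 (fst p)"
    by (rule paste_closed [of ?H0 ?H1 "\<lambda>p. c0 (fst p)" "\<lambda>p. c1 (fst p)"])
      (use assms cont_fst in \<open>auto intro: closed_Times\<close>)
  have closed: "closed (?V0 \<union> ?V1)" "closed (?H0 \<union> ?H1)"
    by (auto intro: closed_Times)
  have agree: "v p = h p" if "p \<in> ?V0 \<union> ?V1" "p \<in> ?H0 \<union> ?H1" for p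
    using that v(2,3) [of p] h(2,3) [of p] assms(1,10-) by auto
  let ?S = "(?V0 \<union> ?V1) \<union> (?H0 \<union> ?H1)"
  obtain f where f: "continuous_on ?S f"
    "\<And>p. p \<in> ?V0 \<union> ?V1 \<Longrightarrow> f p = v p" "\<And>p. p \<in> ?H0 \<union> ?H1 \<Longrightarrow> f p = h p"
    using paste_closed [OF closed v(1) h(1) agree] by blast
  have fV: "f p = e0 (snd p)" if "p \<in> ?V0" for p
    using f(2) v(2) that by auto
  have fV': "f p = e1 (snd p)" if "p \<in> ?V1" for p
    using f(2) v(3) that by auto
  have fH: "f p = c0 (fst p)" if "p \<in> ?H0" for p
    using f(3) h(2) that by auto
  have fH': "f p = c1 (fst p)" if "p \<in> ?H1" for p
    using f(3) h(3) that by auto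
  let ?C = "{0..1::real} \<times> {0..r}"
  have cb: "?C = cbox (0, 0) (1, r)"
    by (auto simp: cbox_Pair_eq)
  have pol: "polytope ?C"
    unfolding cb by (rule polytope_interval)
  have ad: "aff_dim ?C \<le> 3"
    using aff_dim_le_DIM [of ?C] by simp
  have sub: "?S \<subseteq> ?C"
    using assms(1) by auto
  have fim: "f ` ?S \<subseteq> ucover"
  proof
    fix z assume "z \<in> f ` ?S"
    then obtain p where p: "p \<in> ?S" "z = f p"
      by blast
    then consider "p \<in> ?V0" | "p \<in> ?V1" | "p \<in> ?H0" | "p \<in> ?H1"
      by blast
    then show "z \<in> ucover"
      by cases (use fV fV' fH fH' assms(6-9) p(2) in \<open>force+\<close>)
  qed
  obtain E where E: "continuous_on ?C E" "E ` ?C \<subseteq> ucover" "\<And>p. p \<in> ?S \<Longrightarrow> E p = f p"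
    using ucover_extension [OF pol ad _ sub f(1) fim] closed by blast
  show ?thesis
    by (rule that [OF E(1,2)]) (use E(3) fV fV' fH fH' in auto)
qed

locale ucover_involution =
  fixes \<iota> :: "(complex^'n^'n) \<times> real \<Rightarrow> (complex^'n^'n) \<times> real"
  assumes cont_inv: "continuous_on ucover \<iota>"
    and inv_in: "z \<in> ucover \<Longrightarrow> \<iota> z \<in> ucover"
    and inv_inv: "\<iota> (\<iota> z) = z"
begin

lemma fold_symmetric_strip:
  fixes E :: "real \<times> real \<Rightarrow> (complex^'n^'n) \<times> real"
  assumes "continuous_on ({0..1} \<times> {0..r}) E" "E ` ({0..1} \<times> {0..r}) \<subseteq> ucover" "0 \<le> r"
    and "\<And>t. t \<in> {0..1} \<Longrightarrow> \<iota> (E (t, 0)) = E (t, 0)"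
  obtains L where "continuous_on ({0..1} \<times> {-r..r}) L" "L ` ({0..1} \<times> {-r..r}) \<subseteq> ucover"
    "\<And>t y. t \<in> {0..1} \<Longrightarrow> y \<in> {0..r} \<Longrightarrow> L (t, y) = E (t, y)"
    "\<And>t y. t \<in> {0..1} \<Longrightarrow> y \<in> {-r..r} \<Longrightarrow> L (t, -y) = \<iota> (L (t, y))"
proof -
  let ?P = "{0..1::real} \<times> {0..r}" and ?N = "{0..1::real} \<times> {-r..0}"
  have "continuous_on ?N (\<lambda>p. E (fst p, - snd p))"
    by (rule continuous_on_compose2 [OF assms(1)]) (auto intro!: continuous_intros)
  then have contN: "continuous_on ?N (\<lambda>p. \<iota> (E (fst p, - snd p)))"
    by (rule continuous_on_compose2 [OF cont_inv]) (use assms(2) in auto)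
  obtain L where L: "continuous_on (?P \<union> ?N) L" "\<And>p. p \<in> ?P \<Longrightarrow> L p = E p"
      "\<And>p. p \<in> ?N \<Longrightarrow> L p = \<iota> (E (fst p, - snd p))"
    by (rule paste_closed [OF _ _ assms(1) contN])
      (use assms(4) in \<open>auto intro!: closed_Times\<close>)
  have PN: "?P \<union> ?N = {0..1} \<times> {-r..r}"
    using assms(3) by auto
  show ?thesis
  proof (rule that)
    show "continuous_on ({0..1} \<times> {-r..r}) L"
      using L(1) PN by simp
    have "L p \<in> ucover" if "p \<in> ?P \<union> ?N" for p
      using that L(2,3) assms(2) by (auto intro!: inv_in simp: image_subset_iff)
    then show "L ` ({0..1} \<times> {-r..r}) \<subseteq> ucover"
      using PN by auto
    show "L (t, y) = E (t, y)" if "t \<in> {0..1}" "y \<in> {0..r}" for t y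
      using L(2) that by auto
    show "L (t, -y) = \<iota> (L (t, y))" if "t \<in> {0..1}" "y \<in> {-r..r}" for t y
    proof (cases "0 \<le> y")
      case True
      then show ?thesis
        using L(2) [of "(t, y)"] L(3) [of "(t, -y)"] that by simp
    next
      case False
      then show ?thesis
        using L(2) [of "(t, -y)"] L(3) [of "(t, y)"] that by (simp add: inv_inv)
    qed
  qed
qed

definition equivariant_map :: "(real \<times> real \<Rightarrow> (complex^'n^'n) \<times> real) \<Rightarrow> bool" where
  "equivariant_map x \<longleftrightarrow> continuous_on UNIV x \<and> range x \<subseteq> ucover \<and>
    (\<forall>a b. x (-a, -b) = \<iota> (x (a, b))) \<and>
    (\<forall>a b (m::int) (n::int). x (a + of_int m, b + of_int n) = x (a, b))"

lemma equivariant_homotopy_on_cell: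
  fixes x0 x1 :: "real \<times> real \<Rightarrow> (complex^'n^'n) \<times> real"
  assumes x0: "equivariant_map x0" and x1: "equivariant_map x1"
    and corners: "\<And>a b. a \<in> {0, 1/2} \<Longrightarrow> b \<in> {0, 1/2} \<Longrightarrow>
      \<exists>c. continuous_on {0..1::real} c \<and> (\<forall>t\<in>{0..1}. c t \<in> ucover \<and> \<iota> (c t) = c t) \<and>
        c 0 = x0 (a, b) \<and> c 1 = x1 (a, b)"
  obtains \<Phi> :: "real \<times> real \<times> real \<Rightarrow> (complex^'n^'n) \<times> real"
  where "continuous_on ({0..1} \<times> {0..1/2} \<times> {-(1/2)..1/2}) \<Phi>"
    "\<Phi> ` ({0..1} \<times> {0..1/2} \<times> {-(1/2)..1/2}) \<subseteq> ucover"
    "\<And>a b. a \<in> {0..1/2} \<Longrightarrow> b \<in> {-(1/2)..1/2} \<Longrightarrow> \<Phi> (0, a, b) = x0 (a, b)"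
    "\<And>a b. a \<in> {0..1/2} \<Longrightarrow> b \<in> {-(1/2)..1/2} \<Longrightarrow> \<Phi> (1, a, b) = x1 (a, b)"
    "\<And>t b. t \<in> {0..1} \<Longrightarrow> b \<in> {-(1/2)..1/2} \<Longrightarrow> \<Phi> (t, 0, -b) = \<iota> (\<Phi> (t, 0, b))"
    "\<And>t b. t \<in> {0..1} \<Longrightarrow> b \<in> {-(1/2)..1/2} \<Longrightarrow> \<Phi> (t, 1/2, -b) = \<iota> (\<Phi> (t, 1/2, b))"
    "\<And>t a. t \<in> {0..1} \<Longrightarrow> a \<in> {0..1/2} \<Longrightarrow> \<Phi> (t, a, -(1/2)) = \<Phi> (t, a, 1/2)"
proof -
  have inx: "x0 p \<in> ucover" "x1 p \<in> ucover" for p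
    using x0 x1 by (auto simp: equivariant_map_def)
  have cx: "continuous_on S x0" "continuous_on S x1" for S
    using x0 x1 by (auto simp: equivariant_map_def intro: continuous_on_subset)
  have cx': "continuous_on S (\<lambda>s. x0 (f s))" "continuous_on S (\<lambda>s. x1 (f s))" if "continuous_on S f"
    for S :: "'b::topological_space set" and f
    using continuous_on_compose2 [OF cx(1) [of UNIV] that] continuous_on_compose2 [OF cx(2) [of UNIV] that]
    by auto
  have symm: "x (a, -b) = \<iota> (x (a, b))" if "equivariant_map x" "a \<in> {0, 1/2}" for x a b
  proof (cases "a = 0")
    case True
    then show ?thesis
      using that(1) unfolding equivariant_map_def by (metis neg_equal_0_iff_equal)
  next
    case False
    then have "a = -a + of_int 1" "-b = -b + of_int 0"
      using that by auto
    then have "x (a, -b) = x (-a + of_int 1, -b + of_int 0)"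
      by presburger
    also have "\<dots> = \<iota> (x (a, b))"
      using that(1) unfolding equivariant_map_def by metis
    finally show ?thesis .
  qed
  have per: "x (a, -(1/2)) = x (a, 1/2)" if "equivariant_map x" for x a
  proof -
    have "x (a + of_int 0, -(1/2) + of_int 1) = x (a, -(1/2))"
      using that unfolding equivariant_map_def by blast
    then show ?thesis
      by simp
  qed
  obtain c :: "real \<Rightarrow> real \<Rightarrow> real \<Rightarrow> (complex^'n^'n) \<times> real" where c: "\<And>a b. a \<in> {0, 1/2} \<Longrightarrow> b \<in> {0, 1/2} \<Longrightarrow>
      continuous_on {0..1} (c a b) \<and> (\<forall>t\<in>{0..1}. c a b t \<in> ucover \<and> \<iota> (c a b t) = c a b t) \<and>
        c a b 0 = x0 (a, b) \<and> c a b 1 = x1 (a, b)"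
  proof -
    define Q where "Q a b c \<longleftrightarrow> continuous_on {0..1} c \<and> (\<forall>t\<in>{0..1}. c t \<in> ucover \<and> \<iota> (c t) = c t) \<and>
      c 0 = x0 (a, b) \<and> c 1 = x1 (a, b)" for a b and c :: "real \<Rightarrow> (complex^'n^'n) \<times> real"
    have "\<exists>c. Q a b c" if "a \<in> {0, 1/2}" "b \<in> {0, 1/2}" for a b
      using corners [OF that] unfolding Q_def .
    then obtain c where c: "\<And>a b. a \<in> {0, 1/2} \<Longrightarrow> b \<in> {0, 1/2} \<Longrightarrow> Q a b (c a b)"
      by metis
    show ?thesis
      by (rule that [OF c [unfolded Q_def]])
  qed
  have side: "\<exists>L. continuous_on ({0..1} \<times> {-(1/2)..1/2}) L \<and> L ` ({0..1} \<times> {-(1/2)..1/2}) \<subseteq> ucover \<and>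
      (\<forall>t\<in>{0..1}. \<forall>b\<in>{-(1/2)..1/2}. L (t, -b) = \<iota> (L (t, b))) \<and>
      (\<forall>b\<in>{-(1/2)..1/2}. L (0, b) = x0 (a, b) \<and> L (1, b) = x1 (a, b)) \<and>
      (\<forall>t\<in>{0..1}. L (t, 1/2) = c a (1/2) t \<and> L (t, -(1/2)) = c a (1/2) t)" if a: "a \<in> {0, 1/2}" for a
  proof -
    note ca = c [OF a, of 0] c [OF a, of "1/2"]
    obtain E where E: "continuous_on ({0..1} \<times> {0..1/2}) E" "E ` ({0..1} \<times> {0..1/2}) \<subseteq> ucover"
      "\<And>s. s \<in> {0..1/2} \<Longrightarrow> E (0, s) = x0 (a, s)" "\<And>s. s \<in> {0..1/2} \<Longrightarrow> E (1, s) = x1 (a, s)"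
      "\<And>t. t \<in> {0..1} \<Longrightarrow> E (t, 0) = c a 0 t" "\<And>t. t \<in> {0..1} \<Longrightarrow> E (t, 1/2) = c a (1/2) t"
      by (rule ucover_fill_square [of "1/2" "\<lambda>s. x0 (a, s)" "\<lambda>s. x1 (a, s)" "c a 0" "c a (1/2)"])
        (use ca inx in \<open>auto intro!: cx' continuous_intros\<close>)
    have "\<iota> (E (t, 0)) = E (t, 0)" if "t \<in> {0..1}" for t
      using that E(5) ca by auto
    then obtain L where L: "continuous_on ({0..1} \<times> {-(1/2)..1/2}) L" "L ` ({0..1} \<times> {-(1/2)..1/2}) \<subseteq> ucover"
      "\<And>t y. t \<in> {0..1} \<Longrightarrow> y \<in> {0..1/2} \<Longrightarrow> L (t, y) = E (t, y)"
      "\<And>t y. t \<in> {0..1} \<Longrightarrow> y \<in> {-(1/2)..1/2} \<Longrightarrow> L (t, -y) = \<iota> (L (t, y))"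
      using fold_symmetric_strip [OF E(1,2)] by (metis divide_nonneg_nonneg zero_le_numeral zero_le_one)
    have ends: "L (0, b) = x0 (a, b) \<and> L (1, b) = x1 (a, b)" if "b \<in> {-(1/2)..1/2}" for b
    proof (cases "0 \<le> b")
      case True
      then show ?thesis
        using that L(3) E(3,4) by simp
    next
      case False
      then have "L (0, -b) = x0 (a, -b)" "L (1, -b) = x1 (a, -b)"
        using that L(3) E(3,4) by simp_all
      then have "\<iota> (L (0, b)) = \<iota> (x0 (a, b))" "\<iota> (L (1, b)) = \<iota> (x1 (a, b))"
        using that L(4) symm [OF x0 a] symm [OF x1 a] by simp_all
      then show ?thesis
        by (metis inv_inv)
    qed
    have top: "L (t, 1/2) = c a (1/2) t \<and> L (t, -(1/2)) = c a (1/2) t" if "t \<in> {0..1}" for t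
    proof -
      have "L (t, 1/2) = c a (1/2) t"
        using that L(3) E(6) by simp
      moreover have "L (t, -(1/2)) = \<iota> (L (t, 1/2))"
        using L(4) that by simp
      ultimately show ?thesis
        using ca(2) that by simp
    qed
    show ?thesis
      using L(1,2,4) ends top by blast
  qed
  obtain L :: "real \<Rightarrow> real \<times> real \<Rightarrow> (complex^'n^'n) \<times> real" where L: "\<And>a. a \<in> {0, 1/2} \<Longrightarrow> continuous_on ({0..1} \<times> {-(1/2)..1/2}) (L a) \<and>
      L a ` ({0..1} \<times> {-(1/2)..1/2}) \<subseteq> ucover \<and>
      (\<forall>t\<in>{0..1}. \<forall>b\<in>{-(1/2)..1/2}. L a (t, -b) = \<iota> (L a (t, b))) \<and>
      (\<forall>b\<in>{-(1/2)..1/2}. L a (0, b) = x0 (a, b) \<and> L a (1, b) = x1 (a, b)) \<and>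
      (\<forall>t\<in>{0..1}. L a (t, 1/2) = c a (1/2) t \<and> L a (t, -(1/2)) = c a (1/2) t)"
  proof -
    define Q where "Q a L \<longleftrightarrow> continuous_on ({0..1} \<times> {-(1/2)..1/2}) L \<and>
      L ` ({0..1} \<times> {-(1/2)..1/2}) \<subseteq> ucover \<and>
      (\<forall>t\<in>{0..1}. \<forall>b\<in>{-(1/2)..1/2}. L (t, -b) = \<iota> (L (t, b))) \<and>
      (\<forall>b\<in>{-(1/2)..1/2}. L (0, b) = x0 (a, b) \<and> L (1, b) = x1 (a, b)) \<and>
      (\<forall>t\<in>{0..1}. L (t, 1/2) = c a (1/2) t \<and> L (t, -(1/2)) = c a (1/2) t)"
      for a and L :: "real \<times> real \<Rightarrow> (complex^'n^'n) \<times> real"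
    have "\<exists>L. Q a L" if "a \<in> {0, 1/2}" for a
      using side [OF that] unfolding Q_def .
    then obtain L where L: "\<And>a. a \<in> {0, 1/2} \<Longrightarrow> Q a (L a)"
      by metis
    show ?thesis
      by (rule that [OF L [unfolded Q_def]])
  qed
  have c01: "continuous_on {0..1} (c 0 (1/2)) \<and> (\<forall>t\<in>{0..1}. c 0 (1/2) t \<in> ucover) \<and>
      c 0 (1/2) 0 = x0 (0, 1/2) \<and> c 0 (1/2) 1 = x1 (0, 1/2)"
    and c11: "continuous_on {0..1} (c (1/2) (1/2)) \<and> (\<forall>t\<in>{0..1}. c (1/2) (1/2) t \<in> ucover) \<and>
      c (1/2) (1/2) 0 = x0 (1/2, 1/2) \<and> c (1/2) (1/2) 1 = x1 (1/2, 1/2)"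
    using c [of 0 "1/2"] c [of "1/2" "1/2"] by blast+
  obtain F where F: "continuous_on ({0..1} \<times> {0..1/2}) F" "F ` ({0..1} \<times> {0..1/2}) \<subseteq> ucover"
    "\<And>s. s \<in> {0..1/2} \<Longrightarrow> F (0, s) = x0 (s, 1/2)" "\<And>s. s \<in> {0..1/2} \<Longrightarrow> F (1, s) = x1 (s, 1/2)"
    "\<And>t. t \<in> {0..1} \<Longrightarrow> F (t, 0) = c 0 (1/2) t" "\<And>t. t \<in> {0..1} \<Longrightarrow> F (t, 1/2) = c (1/2) (1/2) t"
    by (rule ucover_fill_square [of "1/2" "\<lambda>s. x0 (s, 1/2)" "\<lambda>s. x1 (s, 1/2)" "c 0 (1/2)" "c (1/2) (1/2)"])
      (use c01 c11 inx in \<open>auto intro!: cx' continuous_intros\<close>)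
  let ?I = "{0..1::real}" and ?X = "{0..1/2::real}" and ?Y = "{-(1/2)..1/2::real}"
  let ?A0 = "{0::real} \<times> ?X \<times> ?Y" and ?A1 = "{1::real} \<times> ?X \<times> ?Y"
  let ?B0 = "?I \<times> {0::real} \<times> ?Y" and ?B1 = "?I \<times> {1/2::real} \<times> ?Y"
  let ?D = "?I \<times> ?X \<times> {-(1/2), 1/2::real}"
  have cL: "continuous_on (?I \<times> {a'} \<times> ?Y) (\<lambda>p. L a (fst p, snd (snd p)))" if "a \<in> {0, 1/2}" for a a' :: real
  proof -
    have "continuous_on (?I \<times> ?Y) (L a)"
      using L [OF that] by blast
    then show ?thesis
      by (rule continuous_on_compose2) (auto intro!: continuous_intros)
  qed
  have cF: "continuous_on ?D (\<lambda>p. F (fst p, fst (snd p)))"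
    by (rule continuous_on_compose2 [OF F(1)]) (auto intro!: continuous_intros)
  obtain hA where hA: "continuous_on (?A0 \<union> ?A1) hA"
     "\<And>p. p \<in> ?A0 \<Longrightarrow> hA p = x0 (snd p)" "\<And>p. p \<in> ?A1 \<Longrightarrow> hA p = x1 (snd p)"
  proof (rule paste_closed [of ?A0 ?A1 "\<lambda>p. x0 (snd p)" "\<lambda>p. x1 (snd p)"])
    show "continuous_on ?A0 (\<lambda>p. x0 (snd p))" "continuous_on ?A1 (\<lambda>p. x1 (snd p))"
      by (intro cx' continuous_intros)+
  qed (auto intro!: closed_Times)
  obtain hB where hB: "continuous_on (?B0 \<union> ?B1) hB"
     "\<And>p. p \<in> ?B0 \<Longrightarrow> hB p = L 0 (fst p, snd (snd p))"
     "\<And>p. p \<in> ?B1 \<Longrightarrow> hB p = L (1/2) (fst p, snd (snd p))"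
  proof (rule paste_closed [of ?B0 ?B1 "\<lambda>p. L 0 (fst p, snd (snd p))" "\<lambda>p. L (1/2) (fst p, snd (snd p))"])
    show "continuous_on ?B0 (\<lambda>p. L 0 (fst p, snd (snd p)))"
      "continuous_on ?B1 (\<lambda>p. L (1/2) (fst p, snd (snd p)))"
      by (rule cL, simp)+
  qed (auto intro!: closed_Times)
  have hB_eq: "hB (t, a, b) = L a (t, b)" if "a \<in> {0, 1/2}" "t \<in> ?I" "b \<in> ?Y" for t a b
  proof -
    from that(1) consider "a = 0" | "a = 1/2"
      by blast
    then show ?thesis
    proof cases
      case 1
      show ?thesis
        unfolding 1 using hB(2) [of "(t, 0, b)"] that(2,3) by simp
    next
      case 2
      show ?thesis
        unfolding 2 using hB(3) [of "(t, 1/2, b)"] that(2,3) by simp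
    qed
  qed
  have clA: "closed (?A0 \<union> ?A1)" and clB: "closed (?B0 \<union> ?B1)" and clD: "closed ?D"
    by (auto intro!: closed_Times closed_Un)
  have agAB: "hA p = hB p" if pA: "p \<in> ?A0 \<union> ?A1" and pB: "p \<in> ?B0 \<union> ?B1" for p
  proof -
    obtain t a b where p: "p = (t, a, b)"
      by (metis surj_pair)
    have *: "a \<in> {0, 1/2}" "b \<in> ?Y" "t = 0 \<or> t = 1"
      using pA pB p by auto
    have "hB p = L a (t, b)"
      using hB_eq * p by auto
    moreover have "hA p = (if t = 0 then x0 else x1) (a, b)"
      using hA(2,3) [of p] pA p * by auto
    ultimately show ?thesis
      using L [OF *(1)] *(2,3) by auto
  qed
  obtain hAB where hAB: "continuous_on ((?A0 \<union> ?A1) \<union> (?B0 \<union> ?B1)) hAB"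
    "\<And>p. p \<in> ?A0 \<union> ?A1 \<Longrightarrow> hAB p = hA p" "\<And>p. p \<in> ?B0 \<union> ?B1 \<Longrightarrow> hAB p = hB p"
    using paste_closed [OF clA clB hA(1) hB(1) agAB] by blast
  have agD: "hAB p = F (fst p, fst (snd p))" if pAB: "p \<in> (?A0 \<union> ?A1) \<union> (?B0 \<union> ?B1)" and pD: "p \<in> ?D" for p
  proof -
    obtain t a b where p: "p = (t, a, b)"
      by (metis surj_pair)
    have *: "t \<in> ?I" "a \<in> ?X" "b = -(1/2) \<or> b = 1/2"
      using pD p by auto
    from pAB consider "p \<in> ?A0 \<union> ?A1" | "p \<in> ?B0 \<union> ?B1"
      by blast
    then show ?thesis
    proof cases
      case 1
      then have "t = 0 \<or> t = 1"
        using p by auto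
      moreover have "hAB p = (if t = 0 then x0 else x1) (a, b)"
        using hAB(2) [OF 1] hA(2,3) [of p] 1 p by auto
      moreover have "x0 (a, b) = x0 (a, 1/2)" "x1 (a, b) = x1 (a, 1/2)"
        using *(3) per [OF x0, of a] per [OF x1, of a] by metis+
      ultimately show ?thesis
        using F(3,4) *(2) p by auto
    next
      case 2
      then have a: "a \<in> {0, 1/2}"
        using p by auto
      have "hAB p = L a (t, b)"
        using hAB(3) [OF 2] hB_eq [OF a *(1), of b] 2 p by auto
      also have "\<dots> = c a (1/2) t"
        using L [OF a] *(1,3) by metis
      also have "\<dots> = F (t, a)"
        using a F(5,6) [OF *(1)] by (metis insertE singletonD)
      finally show ?thesis
        using p by simp
    qed
  qed
  let ?S = "((?A0 \<union> ?A1) \<union> (?B0 \<union> ?B1)) \<union> ?D"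
  obtain f where f: "continuous_on ?S f" "\<And>p. p \<in> (?A0 \<union> ?A1) \<union> (?B0 \<union> ?B1) \<Longrightarrow> f p = hAB p"
    "\<And>p. p \<in> ?D \<Longrightarrow> f p = F (fst p, fst (snd p))"
    using paste_closed [OF closed_Un [OF clA clB] clD hAB(1) cF agD] by blast
  have fA: "f (0, a, b) = x0 (a, b)" "f (1, a, b) = x1 (a, b)" if "a \<in> ?X" "b \<in> ?Y" for a b
    using f(2) hAB(2) hA(2,3) that by auto
  have fB: "f (t, a, b) = L a (t, b)" if "a \<in> {0, 1/2}" "t \<in> ?I" "b \<in> ?Y" for t a b
  proof -
    have "(t, a, b) \<in> ?B0 \<union> ?B1"
      using that by blast
    then show ?thesis
      using f(2) hAB(3) hB_eq [OF that] by auto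
  qed
  have fD: "f (t, a, b) = F (t, a)" if "t \<in> ?I" "a \<in> ?X" "b = -(1/2) \<or> b = 1/2" for t a b
  proof -
    have "(t, a, b) \<in> ?D"
      using that by blast
    then show ?thesis
      using f(3) by simp
  qed
  have fim: "f ` ?S \<subseteq> ucover"
  proof
    fix z assume "z \<in> f ` ?S"
    then obtain q where q: "q \<in> ?S" "z = f q"
      by (elim imageE)
    obtain t a b where "q = (t, a, b)"
      by (rule prod_cases3)
    then have p: "(t, a, b) \<in> ?S" "z = f (t, a, b)"
      using q by simp_all
    from p(1) consider "(t, a, b) \<in> ?A0 \<union> ?A1" | "(t, a, b) \<in> ?B0 \<union> ?B1" | "(t, a, b) \<in> ?D"
      by blast
    then show "z \<in> ucover"
    proof cases
      case 1
      then show ?thesis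
        using fA inx p(2) by auto
    next
      case 2
      then have *: "a \<in> {0, 1/2}" "(t, b) \<in> ?I \<times> ?Y"
        by auto
      then show ?thesis
        using fB [of a t b] L [OF *(1)] p(2) by auto
    next
      case 3
      then have *: "(t, a) \<in> ?I \<times> ?X"
        by auto
      then show ?thesis
        using 3 fD [of t a b] F(2) p(2) by blast
    qed
  qed
  let ?C = "?I \<times> ?X \<times> ?Y"
  have cb: "?C = cbox (0, 0, -(1/2)) (1, 1/2, 1/2)"
    by (auto simp: cbox_Pair_eq)
  have pol: "polytope ?C"
    unfolding cb by (rule polytope_interval)
  have ad: "aff_dim ?C \<le> 3"
    using aff_dim_le_DIM [of ?C] by simp
  have sub: "?S \<subseteq> ?C"
    by auto
  have clS: "closed ?S"
    using clA clB clD by blast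
  obtain \<Phi> where \<Phi>: "continuous_on ?C \<Phi>" "\<Phi> ` ?C \<subseteq> ucover" "\<And>p. p \<in> ?S \<Longrightarrow> \<Phi> p = f p"
    using ucover_extension [OF pol ad clS sub f(1) fim] by blast
  show ?thesis
  proof (rule that [OF \<Phi>(1,2)])
    fix a b :: real
    assume ab: "a \<in> ?X" "b \<in> ?Y"
    then show "\<Phi> (0, a, b) = x0 (a, b)" "\<Phi> (1, a, b) = x1 (a, b)"
      using \<Phi>(3) fA by auto
  next
    fix t b :: real
    assume tb: "t \<in> ?I" "b \<in> ?Y"
    show "\<Phi> (t, 0, -b) = \<iota> (\<Phi> (t, 0, b))" "\<Phi> (t, 1/2, -b) = \<iota> (\<Phi> (t, 1/2, b))"
      using \<Phi>(3) fB L tb by auto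
  next
    fix t a :: real
    assume "t \<in> ?I" "a \<in> ?X"
    then show "\<Phi> (t, a, -(1/2)) = \<Phi> (t, a, 1/2)"
      using \<Phi>(3) fD by auto
  qed
qed

end

definition wrap :: "real \<Rightarrow> real" where
  "wrap y = frac (y + 1/2) - 1/2"

lemma wrap_eq: "of_int n - 1/2 \<le> y \<Longrightarrow> y < of_int n + 1/2 \<Longrightarrow> wrap y = y - of_int n"
  unfolding wrap_def frac_def by (subst floor_unique [of n]) auto

lemma wrap_range: "-(1/2) \<le> wrap y" "wrap y < 1/2"
  using frac_lt_1 [of "y + 1/2"] by (auto simp: wrap_def)

lemma wrap_int: "\<exists>n. y = wrap y + of_int n"
  unfolding wrap_def frac_def by (rule exI [of _ "\<lfloor>y + 1/2\<rfloor>"]) simp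

lemma wrap_add_int [simp]: "wrap (y + of_int n) = wrap y"
proof -
  obtain m where "y = wrap y + of_int m"
    using wrap_int by blast
  then show ?thesis
    using wrap_range [of y] wrap_eq [of "m + n" "y + of_int n"] by simp
qed

lemma wrap_minus:
  assumes "wrap y \<noteq> -(1/2)"
  shows "wrap (-y) = - wrap y"
proof -
  obtain n where "y = wrap y + of_int n"
    using wrap_int by blast
  then show ?thesis
    using assms wrap_range [of y] wrap_eq [of "-n" "-y"] by simp
qed

lemma wrap_minus_half:
  assumes "wrap y = -(1/2)"
  shows "wrap (-y) = -(1/2)"
proof -
  obtain n where "y = wrap y + of_int n"
    using wrap_int by blast
  then have "- y = of_int (- n) + 1/2"
    using assms by simp
  then show ?thesis
    using wrap_eq [of "1 - n" "-y"] by simp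
qed

lemma continuous_on_periodic_extension:
  fixes f :: "'a::t2_space \<times> real \<Rightarrow> 'b::topological_space"
  assumes K: "closed K" and f: "continuous_on (K \<times> {-(1/2)..1/2}) f"
    and eq: "\<And>s. s \<in> K \<Longrightarrow> f (s, -(1/2)) = f (s, 1/2)"
  shows "continuous_on (K \<times> UNIV) (\<lambda>p. f (fst p, wrap (snd p)))"
proof -
  let ?g = "\<lambda>p. f (fst p, wrap (snd p))"
  let ?T = "\<lambda>n::int. K \<times> {of_int n - 1/2..of_int n + 1/2 :: real}"
  have cont_n: "continuous_on (?T n) ?g" for n
  proof -
    have "continuous_on (?T n) (\<lambda>p. f (fst p, snd p - of_int n))"
      by (rule continuous_on_compose2 [OF f]) (auto intro!: continuous_intros)
    moreover have "f (fst p, snd p - of_int n) = ?g p" if p: "p \<in> ?T n" for p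
    proof (cases "snd p = of_int n + 1/2")
      case True
      then have "wrap (snd p) = -(1/2)"
        using wrap_eq [of "n + 1" "snd p"] by simp
      then show ?thesis
        using eq [of "fst p"] p True by auto
    next
      case False
      then have "wrap (snd p) = snd p - of_int n"
        using p by (intro wrap_eq) auto
      then show ?thesis
        by simp
    qed
    ultimately show ?thesis
      by (rule continuous_on_eq)
  qed
  show ?thesis
    unfolding continuous_on_eq_continuous_within
  proof
    fix p assume p: "p \<in> K \<times> (UNIV :: real set)"
    let ?n = "\<lfloor>snd p\<rfloor>"
    let ?W = "UNIV \<times> {of_int ?n - 1/2<..<of_int ?n + 3/2 :: real}"
    have "of_int ?n - 1/2 < snd p" "snd p < of_int ?n + 3/2"
      by linarith+
    then have pW: "p \<in> ?W"
      by (simp add: mem_Times_iff)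
    have "continuous_on (?T ?n \<union> ?T (?n + 1)) ?g"
      using K by (intro continuous_on_closed_Un cont_n closed_Times closed_atLeastAtMost)
    moreover have pT: "p \<in> ?T ?n \<union> ?T (?n + 1)"
      using p pW by (auto simp: mem_Times_iff)
    ultimately have "continuous (at p within (?T ?n \<union> ?T (?n + 1))) ?g"
      by (simp add: continuous_on_eq_continuous_within)
    moreover have "at p within K \<times> UNIV = at p within (?T ?n \<union> ?T (?n + 1))"
      by (rule at_within_nhd [OF pW]) (auto intro!: open_Times)
    ultimately show "continuous (at p within K \<times> UNIV) ?g"
      by simp
  qed
qed

context ucover_involution
begin

lemma equivariant_homotopy_extension:
  fixes x0 x1 :: "real \<times> real \<Rightarrow> (complex^'n^'n) \<times> real"
  assumes x0: "equivariant_map x0" and x1: "equivariant_map x1"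
    and corners: "\<And>a b. a \<in> {0, 1/2} \<Longrightarrow> b \<in> {0, 1/2} \<Longrightarrow>
      \<exists>c. continuous_on {0..1::real} c \<and> (\<forall>t\<in>{0..1}. c t \<in> ucover \<and> \<iota> (c t) = c t) \<and>
        c 0 = x0 (a, b) \<and> c 1 = x1 (a, b)"
  obtains H :: "real \<times> real \<times> real \<Rightarrow> (complex^'n^'n) \<times> real"
  where "continuous_on ({0..1} \<times> UNIV) H"
    "\<And>t. t \<in> {0..1} \<Longrightarrow> equivariant_map (\<lambda>p. H (t, p))"
    "\<And>p. H (0, p) = x0 p" "\<And>p. H (1, p) = x1 p"
proof -
  let ?I = "{0..1::real}" and ?X = "{0..1/2::real}" and ?Y = "{-(1/2)..1/2::real}"
  obtain \<Phi> where \<Phi>: "continuous_on (?I \<times> ?X \<times> ?Y) \<Phi>" "\<Phi> ` (?I \<times> ?X \<times> ?Y) \<subseteq> ucover"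
    and \<Phi>0: "\<And>a b. a \<in> ?X \<Longrightarrow> b \<in> ?Y \<Longrightarrow> \<Phi> (0, a, b) = x0 (a, b)"
    and \<Phi>1: "\<And>a b. a \<in> ?X \<Longrightarrow> b \<in> ?Y \<Longrightarrow> \<Phi> (1, a, b) = x1 (a, b)"
    and \<Phi>l: "\<And>t b. t \<in> ?I \<Longrightarrow> b \<in> ?Y \<Longrightarrow> \<Phi> (t, 0, -b) = \<iota> (\<Phi> (t, 0, b))"
    and \<Phi>r: "\<And>t b. t \<in> ?I \<Longrightarrow> b \<in> ?Y \<Longrightarrow> \<Phi> (t, 1/2, -b) = \<iota> (\<Phi> (t, 1/2, b))"
    and \<Phi>p: "\<And>t a. t \<in> ?I \<Longrightarrow> a \<in> ?X \<Longrightarrow> \<Phi> (t, a, -(1/2)) = \<Phi> (t, a, 1/2)"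
    using equivariant_homotopy_on_cell [OF x0 x1 corners] by blast
  define \<Psi> where "\<Psi> t a b = \<Phi> (t, a, wrap b)" for t a b
  have wrapY: "wrap b \<in> ?Y" for b
    using wrap_range [of b] by simp
  have \<Psi>_in: "\<Psi> t a b \<in> ucover" if "t \<in> ?I" "a \<in> ?X" for t a b
    using \<Phi>(2) that wrapY [of b] by (auto simp: \<Psi>_def image_subset_iff)
  have \<Psi>_cont: "continuous_on (?I \<times> ?X \<times> UNIV) (\<lambda>p. \<Psi> (fst p) (fst (snd p)) (snd (snd p)))"
  proof -
    have "continuous_on ((?I \<times> ?X) \<times> ?Y) (\<lambda>p. \<Phi> (fst (fst p), snd (fst p), snd p))"
      by (rule continuous_on_compose2 [OF \<Phi>(1)]) (auto intro!: continuous_intros)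
    then have cont: "continuous_on ((?I \<times> ?X) \<times> UNIV) (\<lambda>p. \<Phi> (fst (fst p), snd (fst p), wrap (snd p)))"
      using continuous_on_periodic_extension [of "?I \<times> ?X" "\<lambda>p. \<Phi> (fst (fst p), snd (fst p), snd p)"] \<Phi>p
      by (auto simp: closed_Times)
    have "continuous_on (?I \<times> ?X \<times> UNIV) (\<lambda>p. ((fst p, fst (snd p)), snd (snd p)))"
      by (intro continuous_intros)
    from continuous_on_compose2 [OF cont this] show ?thesis
      by (simp add: \<Psi>_def image_subset_iff)
  qed
  have \<Psi>_symm: "\<Psi> t a (-b) = \<iota> (\<Psi> t a b)" if "t \<in> ?I" "a \<in> {0, 1/2}" for t a b
  proof -
    have sym: "\<Phi> (t, a, -b) = \<iota> (\<Phi> (t, a, b))" if "b \<in> ?Y" for b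
      using \<Phi>l \<Phi>r \<open>t \<in> ?I\<close> \<open>a \<in> {0, 1/2}\<close> that by blast
    show ?thesis
    proof (cases "wrap b = -(1/2)")
      case True
      have "a \<in> ?X"
        using that(2) by auto
      then have "\<Phi> (t, a, -(1/2)) = \<iota> (\<Phi> (t, a, -(1/2)))"
        using sym [of "1/2"] \<Phi>p [OF that(1)] by simp
      then show ?thesis
        unfolding \<Psi>_def True wrap_minus_half [OF True] .
    next
      case False
      show ?thesis
        unfolding \<Psi>_def wrap_minus [OF False] by (rule sym [OF wrapY])
    qed
  qed
  have per: "x (a + of_int m, b + of_int n) = x (a, b)" if "equivariant_map x" for x a b m n
    using that unfolding equivariant_map_def by blast
  have neg: "x (-a, -b) = \<iota> (x (a, b))" if "equivariant_map x" for x a b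
    using that unfolding equivariant_map_def by blast
  have wrap2: "x (a, wrap b) = x (a, b)" if "equivariant_map x" for x a b
    using per [OF that, of a 0] wrap_int [of b] by (metis add.right_neutral of_int_0)
  have wrap1: "x (wrap a, b) = x (a, b)" if "equivariant_map x" for x a b
    using per [OF that, of _ _ b 0] wrap_int [of a] by (metis add.right_neutral of_int_0)
  have \<Psi>01: "\<Psi> 0 a b = x0 (a, b)" "\<Psi> 1 a b = x1 (a, b)" if "a \<in> ?X" for a b
    using \<Phi>0 [OF that wrapY] \<Phi>1 [OF that wrapY] wrap2 [OF x0] wrap2 [OF x1] by (simp_all add: \<Psi>_def)
  let ?R = "?I \<times> ?X \<times> (UNIV :: real set)" and ?L = "?I \<times> {-(1/2)..0::real} \<times> (UNIV :: real set)"
  have "continuous_on ?L (\<lambda>p. \<Psi> (fst p) (- fst (snd p)) (- snd (snd p)))"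
  proof -
    have "continuous_on ?L (\<lambda>p. (fst p, - fst (snd p), - snd (snd p)))"
      by (intro continuous_intros)
    from continuous_on_compose2 [OF \<Psi>_cont this] show ?thesis
      by (simp add: image_subset_iff)
  qed
  then have contL: "continuous_on ?L (\<lambda>p. \<iota> (\<Psi> (fst p) (- fst (snd p)) (- snd (snd p))))"
    by (rule continuous_on_compose2 [OF cont_inv]) (auto intro!: \<Psi>_in)
  have agree: "\<Psi> (fst p) (fst (snd p)) (snd (snd p)) = \<iota> (\<Psi> (fst p) (- fst (snd p)) (- snd (snd p)))"
    if "p \<in> ?R" "p \<in> ?L" for p
  proof -
    have "fst (snd p) = 0" "fst p \<in> ?I"
      using that by auto
    then show ?thesis
      using \<Psi>_symm [of "fst p" 0 "snd (snd p)"] by (simp add: inv_inv)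
  qed
  obtain \<Omega> where \<Omega>: "continuous_on (?R \<union> ?L) \<Omega>"
    "\<And>p. p \<in> ?R \<Longrightarrow> \<Omega> p = \<Psi> (fst p) (fst (snd p)) (snd (snd p))"
    "\<And>p. p \<in> ?L \<Longrightarrow> \<Omega> p = \<iota> (\<Psi> (fst p) (- fst (snd p)) (- snd (snd p)))"
    by (rule paste_closed [OF _ _ \<Psi>_cont contL agree]) (auto intro!: closed_Times)
  have RL: "?R \<union> ?L = ?I \<times> ?Y \<times> UNIV"
    by auto
  have \<Omega>_in: "\<Omega> (t, a, b) \<in> ucover" if "t \<in> ?I" "a \<in> ?Y" for t a b
    using \<Omega>(2,3) [of "(t, a, b)"] that \<Psi>_in [of t a b] \<Psi>_in [of t "-a" "-b"] inv_in
    by (cases "0 \<le> a") auto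
  have \<Omega>_symm: "\<Omega> (t, -a, -b) = \<iota> (\<Omega> (t, a, b))" if "t \<in> ?I" "a \<in> ?Y" for t a b
  proof (cases "0 \<le> a")
    case True
    then show ?thesis
      using \<Omega>(2) [of "(t, a, b)"] \<Omega>(3) [of "(t, -a, -b)"] that by simp
  next
    case False
    then show ?thesis
      using \<Omega>(3) [of "(t, a, b)"] \<Omega>(2) [of "(t, -a, -b)"] that by (simp add: inv_inv)
  qed
  have \<Omega>_ends: "\<Omega> (t, -(1/2), b) = \<Omega> (t, 1/2, b)" if "t \<in> ?I" for t b
    using \<Omega>(3) [of "(t, -(1/2), b)"] \<Omega>(2) [of "(t, 1/2, b)"] \<Psi>_symm [OF that, of "1/2" b] that
    by (simp add: inv_inv)
  have \<Omega>_per: "\<Omega> (t, a, b + of_int n) = \<Omega> (t, a, b)" if "t \<in> ?I" "a \<in> ?Y" for t a b n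
  proof -
    have per\<Psi>: "\<Psi> t a' (b' + of_int n') = \<Psi> t a' b'" for a' b' n'
      by (simp add: \<Psi>_def)
    have "- (b + of_int n) = -b + of_int (-n)"
      by simp
    then have "\<Psi> t a' (- (b + of_int n)) = \<Psi> t a' (-b)" for a'
      using per\<Psi> by metis
    then show ?thesis
      using \<Omega>(2,3) [of "(t, a, b)"] \<Omega>(2,3) [of "(t, a, b + of_int n)"] that per\<Psi>
      by (cases "0 \<le> a") auto
  qed
  have \<Omega>01: "\<Omega> (0, a, b) = x0 (a, b)" "\<Omega> (1, a, b) = x1 (a, b)" if "a \<in> ?Y" for a b
    using \<Omega>(2,3) [of "(0, a, b)"] \<Omega>(2,3) [of "(1, a, b)"] that \<Psi>01 [of a b] \<Psi>01 [of "-a" "-b"]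
      neg [OF x0, of a b] neg [OF x1, of a b]
    by (cases "0 \<le> a"; auto simp: inv_inv)+
  define H where "H p = \<Omega> (fst p, wrap (fst (snd p)), snd (snd p))" for p
  have H_eq: "H (t, a, b) = \<Omega> (t, wrap a, b)" for t a b
    by (simp add: H_def)
  have H_cont: "continuous_on (?I \<times> UNIV) H"
  proof -
    have "continuous_on ((?I \<times> UNIV) \<times> ?Y) (\<lambda>p. \<Omega> (fst (fst p), snd p, snd (fst p)))"
      by (rule continuous_on_compose2 [OF \<Omega>(1)]) (unfold RL, auto intro!: continuous_intros)
    then have cont: "continuous_on ((?I \<times> UNIV) \<times> UNIV) (\<lambda>p. \<Omega> (fst (fst p), wrap (snd p), snd (fst p)))"
      using continuous_on_periodic_extension
          [of "?I \<times> UNIV" "\<lambda>p. \<Omega> (fst (fst p), snd p, snd (fst p))"] \<Omega>_ends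
      by (auto simp: closed_Times)
    have "continuous_on (?I \<times> UNIV) (\<lambda>p. ((fst p, snd (snd p)), fst (snd p)))"
      by (intro continuous_intros)
    from continuous_on_compose2 [OF cont this] show ?thesis
      by (simp add: H_def image_subset_iff)
  qed
  show ?thesis
  proof (rule that [OF H_cont])
    fix t assume t: "t \<in> ?I"
    show "equivariant_map (\<lambda>p. H (t, p))"
      unfolding equivariant_map_def
    proof (intro conjI allI)
      show "continuous_on UNIV (\<lambda>p. H (t, p))"
        by (rule continuous_on_compose2 [OF H_cont]) (use t in \<open>auto intro!: continuous_intros\<close>)
      show "range (\<lambda>p. H (t, p)) \<subseteq> ucover"
        using \<Omega>_in [OF t wrapY] by (auto simp: H_def)
      show "H (t, -a, -b) = \<iota> (H (t, a, b))" for a b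
      proof (cases "wrap a = -(1/2)")
        case True
        have "\<Omega> (t, -(1/2), -b) = \<iota> (\<Omega> (t, -(1/2), b))"
          using \<Omega>_symm [OF t, of "1/2" b] \<Omega>_ends [OF t, of b] by simp
        then show ?thesis
          unfolding H_eq True wrap_minus_half [OF True] .
      next
        case False
        show ?thesis
          unfolding H_eq wrap_minus [OF False] by (rule \<Omega>_symm [OF t wrapY])
      qed
      show "H (t, a + of_int m, b + of_int n) = H (t, a, b)" for a b m n
        using \<Omega>_per [OF t wrapY] by (simp add: H_eq)
    qed
  next
    fix p
    show "H (0, p) = x0 p" "H (1, p) = x1 p"
      using \<Omega>01 [OF wrapY] wrap1 [OF x0] wrap1 [OF x1] by (cases p; simp add: H_eq)+
  qed
qed

end

section \<open>Matrices fixed by the involution\<close>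

lemma cis_eq_1_imp_constant:
  fixes f :: "'a::topological_space \<Rightarrow> real"
  assumes "connected S" "continuous_on S f" "\<And>x. x \<in> S \<Longrightarrow> cis (f x) = 1"
  shows "f constant_on S"
proof (rule continuous_discrete_range_constant [OF assms(1,2)])
  fix x assume x: "x \<in> S"
  have int: "\<exists>n::int. f y = of_int n * 2 * pi" if "y \<in> S" for y
    using assms(3) [OF that] by (metis cis.sel(1) cos_one_2pi_int one_complex.sel(1))
  show "\<exists>e>0. \<forall>y. y \<in> S \<and> f y \<noteq> f x \<longrightarrow> e \<le> norm (f y - f x)"
  proof (intro exI [of _ "2 * pi"] conjI allI impI)
    fix y assume y: "y \<in> S \<and> f y \<noteq> f x"
    obtain m n :: int where mn: "f y = of_int m * 2 * pi" "f x = of_int n * 2 * pi"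
      using int x y by blast
    then have "m \<noteq> n"
      using y by auto
    then have "1 \<le> \<bar>real_of_int (m - n)\<bar>"
      by linarith
    moreover have "f y - f x = real_of_int (m - n) * (2 * pi)"
      using mn by (simp add: left_diff_distrib)
    then have "norm (f y - f x) = \<bar>real_of_int (m - n)\<bar> * (2 * pi)"
      by (simp add: abs_mult)
    ultimately show "2 * pi \<le> norm (f y - f x)"
      by simp
  qed auto
qed

lemma det_eq_0_imp_kernel:
  fixes M :: "complex^'n^'n"
  assumes "det M = 0"
  obtains v where "v \<noteq> 0" "M *v v = 0"
  using assms invertible_det_nz [of M] invertible_left_inverse [of M] matrix_left_invertible_ker [of M] by blast

lemma kernel_imp_det_eq_0:
  fixes M :: "complex^'n^'n"
  assumes "\<And>v. M *v v = 0 \<Longrightarrow> v = 0"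
  shows "det M \<noteq> 0"
  using assms det_eq_0_imp_kernel by metis

lemma exists_phase_avoiding_spectrum:
  fixes A :: "complex^'n^'n"
  assumes "unitary_mat A"
  obtains s where "det (mat 1 + mat (cis s) ** A) \<noteq> 0"
proof -
  have "\<exists>z. norm z = 1 \<and> det (mat 1 + mat z ** A) \<noteq> 0"
  proof (rule ccontr)
    assume sing: "\<not> (\<exists>z. norm z = 1 \<and> det (mat 1 + mat z ** A) \<noteq> 0)"
    have "\<exists>v. v \<noteq> 0 \<and> A *v v = (- cnj z) *s v" if "norm z = 1" for z :: complex
    proof -
      have "norm z = 1"
        using that by simp
      then have "det (mat 1 + mat z ** A) = 0"
        using sing by blast
      then obtain v where v: "v \<noteq> 0" "(mat 1 + mat z ** A) *v v = 0"
        by (rule det_eq_0_imp_kernel)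
      then have "v + z *s (A *v v) = 0"
        by (simp add: matrix_vector_mult_add_rdistrib matrix_vector_mul_assoc [symmetric] mat_mult_vector)
      then have "cnj z *s (z *s (A *v v)) = cnj z *s (- v)"
        by (metis add_eq_0_iff)
      moreover have "cnj z * z = 1"
        using that by (simp add: complex_norm_square [symmetric] mult.commute)
      ultimately have "A *v v = (- cnj z) *s v"
        by (simp add: vec_eq_iff mult.assoc [symmetric])
      then show ?thesis
        using v by blast
    qed
    then obtain v where v: "\<And>z::complex. norm z = 1 \<Longrightarrow> v z \<noteq> 0 \<and> A *v v z = (- cnj z) *s v z"
      by metis
    have orth: "inner (v z) (v w) = 0" if "norm z = 1" "norm w = 1" "z \<noteq> w" for z w
    proof -
      have "hdot (v z) (v w) = hdot (A *v v z) (A *v v w)"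
        using hdot_unitary [OF assms] by simp
      also have "\<dots> = z * cnj w * hdot (v z) (v w)"
        using v that by (simp only: hdot_scale_left hdot_scale_right) simp
      finally have "hdot (v z) (v w) = z * cnj w * hdot (v z) (v w)" .
      moreover have "z * cnj w \<noteq> 1"
      proof
        assume "z * cnj w = 1"
        then have "z * (cnj w * w) = w"
          by (simp add: mult.assoc [symmetric])
        moreover have "cnj w * w = 1"
          using that by (simp add: complex_norm_square [symmetric] mult.commute)
        ultimately show False
          using that by simp
      qed
      ultimately have "hdot (v z) (v w) = 0"
        by auto
      then show ?thesis
        by (metis Re_hdot zero_complex.sel(1))
    qed
    let ?C = "sphere 0 1 :: complex set"
    have "inj_on v ?C"
      using orth v by (intro inj_onI) (metis inner_eq_zero_iff mem_sphere_0)
    moreover have "infinite ?C"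
    proof -
      have "connected ?C"
        by (rule connected_sphere) simp
      moreover have "?C \<noteq> {a}" for a
      proof
        assume "?C = {a}"
        moreover have "(1::complex) \<in> ?C" "(-1::complex) \<in> ?C"
          by auto
        ultimately have "(1::complex) = a" "(-1::complex) = a"
          by blast+
        then show False
          by (metis one_neq_neg_one)
      qed
      moreover have "?C \<noteq> {}"
        by (auto intro: exI [of _ 1])
      ultimately show ?thesis
        using connected_finite_iff_sing by metis
    qed
    ultimately have "infinite (v ` ?C)"
      using finite_imageD by blast
    moreover have "independent (v ` ?C)"
      using v by (intro pairwise_orthogonal_independent)
        (auto simp: pairwise_def orthogonal_def intro!: orth)
    ultimately show False
      using independent_imp_finite by blast
  qed
  then obtain z where "norm z = 1" "det (mat 1 + mat z ** A) \<noteq> 0"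
    by blast
  then show ?thesis
    using that [of "Arg z"] rcis_cmod_Arg [of z] by (simp add: rcis_def)
qed

lemma continuous_matrix_inverse:
  fixes f :: "'a::topological_space \<Rightarrow> complex^'n^'n"
  assumes "continuous_on S f" "\<And>x. x \<in> S \<Longrightarrow> det (f x) \<noteq> 0"
  obtains g where "continuous_on S g" "\<And>x. x \<in> S \<Longrightarrow> f x ** g x = mat 1" "\<And>x. x \<in> S \<Longrightarrow> g x ** f x = mat 1"
proof -
  define g where "g x = (\<chi> k l. det (\<chi> i j. if j = k then axis l 1 $ i else f x $ i $ j) / det (f x))" for x
  have cont: "continuous_on S (\<lambda>x. if j = k then axis l 1 $ i else f x $ i $ j)" for i j k l :: 'n
    using assms(1) by (cases "j = k") (auto intro!: continuous_intros)
  have "continuous_on S g"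
    unfolding g_def using assms(2)
    by (intro continuous_on_vec_lambda continuous_on_divide continuous_on_det cont assms(1)) auto
  moreover have fg: "f x ** g x = mat 1" if "x \<in> S" for x
  proof -
    have "f x *v (\<chi> k. g x $ k $ l) = axis l 1" for l
      using cramer [OF assms(2) [OF that], of "\<chi> k. g x $ k $ l" "axis l 1"] by (simp add: g_def)
    then have "(f x *v (\<chi> k. g x $ k $ l)) $ i = axis l 1 $ i" for i l
      by simp
    then show ?thesis
      by (simp add: vec_eq_iff matrix_vector_mult_def matrix_matrix_mult_def mat_def axis_def)
  qed
  moreover have "g x ** f x = mat 1" if "x \<in> S" for x
    using fg [OF that] matrix_left_right_inverse by blast
  ultimately show ?thesis
    using that by blast
qed

lemma affine_matrix_mult:
  fixes X Y :: "complex^'n^'n"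
  shows "(mat a + mat b ** X) ** (mat c + mat d ** Y)
    = mat (a * c) + mat (a * d) ** Y + mat (b * c) ** X + mat (b * d) ** (X ** Y)"
proof -
  have "mat b ** X ** (mat d ** Y) = mat b ** (X ** mat d) ** Y"
    by (simp add: matrix_mul_assoc)
  also have "\<dots> = mat (b * d) ** (X ** Y)"
    by (simp only: mat_mult_commute [of X]) (simp add: matrix_mul_assoc mat_mult_mat)
  moreover have "mat b ** X ** mat c = mat (b * c) ** X"
    by (simp only: mat_mult_commute [of _ c]) (simp add: matrix_mul_assoc mat_mult_mat mult.commute)
  ultimately show ?thesis
    by (simp add: matrix_add_ldistrib matrix_add_rdistrib matrix_mul_assoc mat_mult_mat)
qed

locale matching_involution =
  fixes \<epsilon> :: "complex^'n^'n"
  assumes unitary_eps: "unitary_mat \<epsilon>"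
    and transpose_eps: "transpose \<epsilon> = \<epsilon> \<or> transpose \<epsilon> = - \<epsilon>"
begin

definition \<sigma> :: "complex^'n^'n \<Rightarrow> complex^'n^'n" where
  "\<sigma> A = cadjoint \<epsilon> ** transpose A ** \<epsilon>"

lemma eps_cancel: "\<epsilon> ** cadjoint \<epsilon> = mat 1" "cadjoint \<epsilon> ** \<epsilon> = mat 1"
  using unitary_eps by (auto simp: unitary_mat_def)

lemma sigma_mult: "\<sigma> (A ** B) = \<sigma> B ** \<sigma> A"
proof -
  have "\<sigma> B ** \<sigma> A = cadjoint \<epsilon> ** transpose B ** (\<epsilon> ** cadjoint \<epsilon>) ** transpose A ** \<epsilon>"
    by (simp add: \<sigma>_def matrix_mul_assoc)
  then show ?thesis
    by (simp add: eps_cancel) (simp add: \<sigma>_def matrix_transpose_mul matrix_mul_assoc)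
qed

lemma sigma_add: "\<sigma> (A + B) = \<sigma> A + \<sigma> B"
proof -
  have "transpose (A + B) = transpose A + transpose B"
    by (simp add: vec_eq_iff transpose_def)
  then show ?thesis
    by (simp add: \<sigma>_def matrix_add_ldistrib matrix_add_rdistrib)
qed

lemma sigma_mat: "\<sigma> (mat z) = mat z"
proof -
  have "\<sigma> (mat z) = mat z ** (cadjoint \<epsilon> ** \<epsilon>)"
    by (simp add: \<sigma>_def mat_mult_commute matrix_mul_assoc)
  then show ?thesis
    by (simp add: eps_cancel)
qed

lemma sigma_sigma: "\<sigma> (\<sigma> A) = A"
proof -
  have tr: "transpose (cadjoint \<epsilon>) = cadjoint (transpose \<epsilon>)"
    by (simp add: vec_eq_iff transpose_def cadjoint_def)
  have neg: "X ** (- Y) = - (X ** Y)" "(- X) ** Y = - (X ** Y)" "cadjoint (- X) = - cadjoint X"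
    for X Y :: "complex^'n^'n"
    by (simp_all add: vec_eq_iff matrix_matrix_mult_def cadjoint_def sum_negf)
  have "\<sigma> (\<sigma> A) = (cadjoint \<epsilon> ** transpose \<epsilon>) ** A ** (cadjoint (transpose \<epsilon>) ** \<epsilon>)"
    by (simp add: \<sigma>_def matrix_transpose_mul tr matrix_mul_assoc)
  then show ?thesis
    using transpose_eps by (auto simp: neg eps_cancel)
qed

lemma unitary_sigma:
  assumes "unitary_mat A"
  shows "unitary_mat (\<sigma> A)"
proof -
  have "cadjoint (transpose A) = transpose (cadjoint A)"
    by (simp add: vec_eq_iff transpose_def cadjoint_def)
  moreover have "transpose (cadjoint A ** A) = mat 1"
    using assms by (simp add: unitary_mat_def)
  ultimately have "unitary_mat (transpose A)"
    by (intro unitary_matI) (simp add: matrix_transpose_mul)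
  then show ?thesis
    unfolding \<sigma>_def by (intro unitary_mat_mult unitary_mat_cadjoint unitary_eps)
qed

lemma det_sigma: "det (\<sigma> A) = det A"
proof -
  have "det (cadjoint \<epsilon>) * det \<epsilon> = 1"
    using eps_cancel(2) by (metis det_I det_mul)
  then show ?thesis
    by (simp add: \<sigma>_def det_mul)
qed

lemma continuous_on_sigma [continuous_intros]:
  "continuous_on S f \<Longrightarrow> continuous_on S (\<lambda>x. \<sigma> (f x))"
  unfolding \<sigma>_def by (intro continuous_intros)

definition Fix :: "(complex^'n^'n) set" where
  "Fix = {A. unitary_mat A \<and> \<sigma> A = A}"

text \<open>The inverse Cayley transform of a path of multiples of the Cayley transform of \<open>B\<close>; it moves each
  eigenvalue of \<open>B\<close> along the unit circle to \<open>1\<close> without crossing \<open>-1\<close>.\<close>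
lemma path_component_Fix_one:
  assumes B: "B \<in> Fix" and nz: "det (mat 1 + B) \<noteq> 0"
  shows "path_component Fix (mat 1) B"
proof -
  let ?a = "\<lambda>t::real. complex_of_real (1 + t)" and ?b = "\<lambda>t::real. complex_of_real (1 - t)"
  define M where "M t = mat (?a t) + mat (?b t) ** B" for t
  define N where "N t = mat (?b t) + mat (?a t) ** B" for t
  have uB: "unitary_mat B" and sB: "\<sigma> B = B"
    using B by (auto simp: Fix_def)
  have contM: "continuous_on {0..1} M" and contN: "continuous_on {0..1} N"
    unfolding M_def N_def by (intro continuous_intros)+
  have "det (M t) \<noteq> 0" if t: "t \<in> {0..1}" for t
  proof (cases "t = 0")
    case True
    then show ?thesis
      using nz by (simp add: M_def)
  next
    case False
    show ?thesis
    proof (rule kernel_imp_det_eq_0)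
      fix v assume "M t *v v = 0"
      then have "?a t *s v + ?b t *s (B *v v) = 0"
        by (simp add: M_def matrix_vector_mult_add_rdistrib matrix_vector_mul_assoc [symmetric] mat_mult_vector)
      moreover have "complex_of_real r *s w = r *\<^sub>R w" for r and w :: "complex^'n"
        by (simp only: vec_eq_iff vector_smult_component vector_scaleR_component)
          (simp add: scaleR_conv_of_real)
      ultimately have "(1 + t) *\<^sub>R v = - ((1 - t) *\<^sub>R (B *v v))"
        by (metis add_eq_0_iff2)
      then have "norm ((1 + t) *\<^sub>R v) = norm ((1 - t) *\<^sub>R (B *v v))"
        by simp
      then have "(1 + t) * norm v = (1 - t) * norm v"
        using t by (simp add: norm_unitary [OF uB])
      then show "v = 0"
        using False by (simp add: algebra_simps)
    qed
  qed
  then obtain X where X: "continuous_on {0..1} X"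
    "\<And>t. t \<in> {0..1} \<Longrightarrow> M t ** X t = mat 1" "\<And>t. t \<in> {0..1} \<Longrightarrow> X t ** M t = mat 1"
    using continuous_matrix_inverse [OF contM] by blast
  have MN: "M t ** N t = N t ** M t" for t
    by (simp add: M_def N_def affine_matrix_mult mult.commute)
  have comm: "X t ** N t = N t ** X t" if "t \<in> {0..1}" for t
  proof -
    have "X t ** N t = X t ** N t ** (M t ** X t)"
      using X(2) [OF that] by simp
    also have "\<dots> = X t ** (M t ** N t) ** X t"
      by (simp add: MN matrix_mul_assoc)
    also have "\<dots> = N t ** X t"
      using X(3) [OF that] by (simp add: matrix_mul_assoc)
    finally show ?thesis .
  qed
  have MM: "M t ** cadjoint (M t) = N t ** cadjoint (N t)" for t
  proof -
    have "(mat a + mat b ** B) ** (mat a + mat b ** cadjoint B)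
        = (mat b + mat a ** B) ** (mat b + mat a ** cadjoint B)" for a b
      using uB by (simp add: affine_matrix_mult unitary_mat_def mult.commute add_ac)
    moreover have "cadjoint (M t) = mat (?a t) + mat (?b t) ** cadjoint B"
      "cadjoint (N t) = mat (?b t) + mat (?a t) ** cadjoint B"
      by (simp_all add: M_def N_def cadjoint_add cadjoint_mult mat_mult_commute [of "cadjoint B"])
    ultimately show ?thesis
      by (simp add: M_def N_def)
  qed
  have uni: "unitary_mat (N t ** X t)" if "t \<in> {0..1}" for t
  proof (rule unitary_matI)
    have "(N t ** X t) ** cadjoint (N t ** X t) = (X t ** N t) ** cadjoint (X t ** N t)"
      using comm [OF that] by simp
    also have "\<dots> = X t ** (N t ** cadjoint (N t)) ** cadjoint (X t)"
      by (simp add: cadjoint_mult matrix_mul_assoc)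
    also have "\<dots> = (X t ** M t) ** (cadjoint (M t) ** cadjoint (X t))"
      by (simp add: MM [symmetric] matrix_mul_assoc)
    also have "\<dots> = (X t ** M t) ** cadjoint (X t ** M t)"
      by (simp add: cadjoint_mult)
    finally show "(N t ** X t) ** cadjoint (N t ** X t) = mat 1"
      using X(3) [OF that] by simp
  qed
  have sM: "\<sigma> (M t) = M t" and sN: "\<sigma> (N t) = N t" for t
    by (simp_all add: M_def N_def sigma_add sigma_mult sigma_mat sB mat_mult_commute)
  have sX: "\<sigma> (X t) = X t" if "t \<in> {0..1}" for t
  proof -
    have "\<sigma> (X t) ** M t = mat 1"
      using X(2) [OF that] by (metis sM sigma_mat sigma_mult)
    then have "\<sigma> (X t) ** M t ** X t = X t"
      by simp
    then show ?thesis
      using X(2) [OF that] by (simp add: matrix_mul_assoc [symmetric])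
  qed
  have "N t ** X t \<in> Fix" if "t \<in> {0..1}" for t
    using uni [OF that] sX [OF that] sN comm [OF that] by (simp add: Fix_def sigma_mult)
  moreover have "N 0 ** X 0 = mat 1"
    using X(2) [of 0] by (simp add: M_def N_def)
  moreover have "N 1 ** X 1 = B"
  proof -
    have "N 1 ** X 1 = mat 2 ** X 1 ** B"
      using comm [of 1] by (simp add: N_def mat_mult_commute matrix_mul_assoc)
    also have "\<dots> = B"
      using X(2) [of 1] by (simp add: M_def)
    finally show ?thesis .
  qed
  moreover have "continuous_on {0..1} (\<lambda>t. N t ** X t)"
    by (intro continuous_intros contN X(1))
  ultimately show ?thesis
    unfolding path_component_def path_def path_image_def pathstart_def pathfinish_def
    by (intro exI [of _ "\<lambda>t. N t ** X t"]) auto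
qed

lemma path_connected_Fix: "path_connected Fix"
proof -
  have "path_component Fix (mat 1) A" if A: "A \<in> Fix" for A
  proof -
    have uA: "unitary_mat A" and sA: "\<sigma> A = A"
      using A by (auto simp: Fix_def)
    obtain s where s: "det (mat 1 + mat (cis s) ** A) \<noteq> 0"
      using exists_phase_avoiding_spectrum uA by blast
    have *: "mat (cis r) ** A \<in> Fix" for r
      by (simp add: Fix_def uA sA sigma_mult sigma_mat mat_mult_commute unitary_mat_mult unitary_mat_mat)
    have "path_component Fix (mat (cis s) ** A) A"
      unfolding path_component_def path_def path_image_def pathstart_def pathfinish_def
      by (rule exI [of _ "\<lambda>t. mat (cis (s * (1 - t))) ** A"]) (auto intro!: continuous_intros simp: *)
    with path_component_Fix_one [OF * s] show ?thesis
      by (rule path_component_trans)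
  qed
  then show ?thesis
    unfolding path_connected_component by (meson path_component_sym path_component_trans)
qed

text \<open>In the fermionic case this set has two components, because the determinant of a fixed matrix is a square.\<close>
definition FixCover :: "((complex^'n^'n) \<times> real) set" where
  "FixCover = {(A, t). A \<in> Fix \<and> det A = cis t}"

lemma path_component_FixCover_shift:
  assumes "path_component FixCover (A, t) (B, u)" "cis e = 1"
  shows "path_component FixCover (A, t + e) (B, u + e)"
proof -
  obtain g where g: "path g" "path_image g \<subseteq> FixCover" "pathstart g = (A, t)" "pathfinish g = (B, u)"
    using assms(1) by (auto simp: path_component_def)
  let ?h = "\<lambda>s. (fst (g s), snd (g s) + e)"
  have "path ?h"
    using g(1) unfolding path_def by (intro continuous_intros)
  moreover have "path_image ?h \<subseteq> FixCover"
    using g(2) assms(2) by (force simp: path_image_def FixCover_def cis_mult [symmetric])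
  ultimately show ?thesis
    using g(3,4) unfolding path_component_def
    by (intro exI [of _ ?h]) (auto simp: pathstart_def pathfinish_def)
qed

lemma path_component_FixCover_lift:
  assumes "A \<in> Fix" "B \<in> Fix" "det A = cis t"
  obtains u where "path_component FixCover (A, t) (B, u)"
proof -
  obtain g where g: "path g" "path_image g \<subseteq> Fix" "pathstart g = A" "pathfinish g = B"
    using path_connected_Fix assms(1,2) unfolding path_connected_def by blast
  have gF: "g s \<in> Fix" if "s \<in> {0..1}" for s
    using g(2) that by (auto simp: path_image_def)
  have "continuous_on {0..1} (\<lambda>s. det (g s))"
    using g(1) unfolding path_def by (rule continuous_on_det)
  moreover have "norm (det (g s)) = 1" if "s \<in> {0..1}" for s
    using gF [OF that] by (simp add: Fix_def norm_det_unitary)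
  ultimately obtain \<theta> where \<theta>: "continuous_on {0..1} \<theta>" "\<And>s. s \<in> {0..1} \<Longrightarrow> det (g s) = cis (\<theta> s)"
    using cis_lift [of "{0..1}" "\<lambda>s. det (g s)"] by (metis convex_real_interval(5))
  have "cis (t - \<theta> 0) = det A / det (g 0)"
    using assms(3) \<theta>(2) [of 0] by (simp add: cis_divide)
  also have "\<dots> = 1"
    using g(3) assms(3) by (auto simp: pathstart_def)
  finally have e: "cis (t - \<theta> 0) = 1" .
  let ?h = "\<lambda>s. (g s, \<theta> s + (t - \<theta> 0))"
  have "path ?h"
    using g(1) unfolding path_def by (intro continuous_intros \<theta>(1))
  moreover have "path_image ?h \<subseteq> FixCover"
    using gF \<theta>(2) e by (auto simp: path_image_def FixCover_def cis_mult [symmetric] simp del: cis_mult)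
  ultimately have "path_component FixCover (A, t) (B, \<theta> 1 + (t - \<theta> 0))"
    using g(3,4) unfolding path_component_def
    by (intro exI [of _ ?h]) (auto simp: pathstart_def pathfinish_def)
  then show ?thesis
    using that by blast
qed

lemma path_component_FixCover_mem:
  assumes "path_component FixCover (A, t) (B, u)"
  shows "A \<in> Fix" "det A = cis t" "B \<in> Fix" "det B = cis u"
  using path_component_mem [OF assms] by (auto simp: FixCover_def)

text \<open>Conjugating a loop at \<open>A\<close> by a path in the connected space \<^term>\<open>Fix\<close> gives a loop at \<open>A'\<close> along
  which the determinant has the same winding number.\<close>
lemma path_component_FixCover_transfer:
  assumes "path_component FixCover (B, u) (A, t + d)" "path_component FixCover (B, u) (A, t + d')"
    and "path_component FixCover (B', u') (A', t' + d)" "det A = cis t" "det A' = cis t'"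
  shows "path_component FixCover (B', u') (A', t' + d')"
proof -
  have A: "A \<in> Fix" "A' \<in> Fix" "cis (t + d) = cis t" "cis (t' + d) = cis t'" "cis (t + d') = cis t"
    using assms path_component_FixCover_mem by metis+
  have d: "cis d = 1" "cis d' = 1"
    using A(3,5) by (simp_all add: cis_mult [symmetric])
  obtain v where v: "path_component FixCover (A', t') (A, v)"
    using path_component_FixCover_lift [OF A(2,1) assms(5)] by blast
  have "cis v = cis t"
    using path_component_FixCover_mem(4) [OF v] assms(4) by simp
  then have e: "cis (v - t) = 1"
    by (simp add: cis_divide [symmetric])
  have "path_component FixCover (A, t + d) (A, t + d')"
    using assms(1,2) by (meson path_component_sym path_component_trans)
  then have "path_component FixCover (A, v + d) (A, v + d')"
    using path_component_FixCover_shift [OF _ e, of A "t + d" A "t + d'"] by (simp add: algebra_simps)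
  moreover have "path_component FixCover (A', t' + d) (A, v + d)" "path_component FixCover (A', t' + d') (A, v + d')"
    using path_component_FixCover_shift [OF v] d by auto
  ultimately show ?thesis
    using assms(3) by (meson path_component_sym path_component_trans)
qed

end

section \<open>Families of matching matrices\<close>

lemma equiv_homotopic_iff:
  fixes \<alpha>0 \<alpha>1 :: "real^'d \<Rightarrow> complex^'n^'n"
  shows "equiv_homotopic \<epsilon> \<alpha>0 \<alpha>1 \<longleftrightarrow>
    (\<exists>h. continuous_on ({0..1::real} \<times> UNIV) h \<and> (\<forall>k. h (0, k) = \<alpha>0 k) \<and> (\<forall>k. h (1, k) = \<alpha>1 k) \<and>
      (\<forall>t\<in>{0..1}. matching_family \<epsilon> (\<lambda>k. h (t, k))))"
proof -
  have "homotopic_with_canon (matching_family \<epsilon>) UNIV UNIV \<alpha>0 \<alpha>1 \<longleftrightarrow>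
      (\<exists>h. continuous_map (prod_topology (top_of_set {0..1::real}) (top_of_set UNIV)) (top_of_set UNIV) h \<and>
        (\<forall>k\<in>topspace (top_of_set UNIV). h (0, k) = \<alpha>0 k) \<and> (\<forall>k\<in>topspace (top_of_set UNIV). h (1, k) = \<alpha>1 k) \<and>
        (\<forall>t\<in>{0..1}. matching_family \<epsilon> (\<lambda>k. h (t, k))))"
    by (rule homotopic_with) (metis UNIV_I ext topspace_euclidean_subtopology)
  then show ?thesis
    unfolding equiv_homotopic_def prod_topology_subtopology_eu by simp
qed

lemma is_J_transpose:
  fixes \<epsilon> :: "complex^'n^'n"
  assumes "is_J \<epsilon>"
  shows "transpose \<epsilon> = - \<epsilon>"
proof -
  obtain e :: "'n \<Rightarrow> nat" where e: "bij_betw e UNIV {0..<CARD('n)}" and ev: "even CARD('n)"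
    and eps: "\<epsilon> = (\<chi> i j. Jnat CARD('n) (e i) (e j))"
    using assms by (auto simp: is_J_def)
  have lt: "e i < CARD('n)" for i
    using e by (auto simp: bij_betw_def)
  have two: "2 * (CARD('n) div 2) = CARD('n)"
    using ev by simp
  have antisym: "Jnat m j i = - Jnat m i j" if "i < m" "j < m" "2 * (m div 2) = m" for i j m
    using that by (auto simp: Jnat_def)
  show ?thesis
    by (simp add: eps vec_eq_iff transpose_def) (blast intro: antisym [OF lt lt two])
qed

lemma is_J_unitary:
  fixes \<epsilon> :: "complex^'n^'n"
  assumes "is_J \<epsilon>"
  shows "unitary_mat \<epsilon>"
proof (rule unitary_matI)
  obtain e :: "'n \<Rightarrow> nat" where e: "bij_betw e UNIV {0..<CARD('n)}" and ev: "even CARD('n)"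
    and eps: "\<epsilon> = (\<chi> i j. Jnat CARD('n) (e i) (e j))"
    using assms by (auto simp: is_J_def)
  define m where "m = CARD('n)"
  have m: "2 * (m div 2) = m"
    using ev by (simp add: m_def)
  have em: "e i < m" for i
    using e by (auto simp: bij_betw_def m_def)
  have inj: "e i = e j \<longleftrightarrow> i = j" for i j
    using e by (auto simp: bij_betw_def inj_on_def)
  have row: "(\<Sum>l\<in>{0..<m}. Jnat m p l * cnj (Jnat m q l)) = (if p = q then 1 else 0)"
    if "p < m" "q < m" for p q
  proof (cases "p < m div 2")
    case True
    then have "(\<Sum>l\<in>{0..<m}. Jnat m p l * cnj (Jnat m q l))
        = (\<Sum>l\<in>{0..<m}. if l = p + m div 2 then cnj (Jnat m q l) else 0)"
      using that m by (intro sum.cong) (auto simp: Jnat_def)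
    also have "\<dots> = cnj (Jnat m q (p + m div 2))"
      using True m by simp
    also have "\<dots> = (if p = q then 1 else 0)"
      using True that m by (auto simp: Jnat_def)
    finally show ?thesis .
  next
    case False
    then have "(\<Sum>l\<in>{0..<m}. Jnat m p l * cnj (Jnat m q l))
        = (\<Sum>l\<in>{0..<m}. if l = p - m div 2 then - cnj (Jnat m q l) else 0)"
      using that m by (intro sum.cong) (auto simp: Jnat_def)
    also have "\<dots> = - cnj (Jnat m q (p - m div 2))"
      using False that m by simp
    also have "\<dots> = (if p = q then 1 else 0)"
      using False that m by (auto simp: Jnat_def)
    finally show ?thesis .
  qed
  have "(\<Sum>k\<in>UNIV. Jnat m (e i) (e k) * cnj (Jnat m (e j) (e k))) = (if i = j then 1 else 0)" for i j
    using sum.reindex_bij_betw [OF e, of "\<lambda>l. Jnat m (e i) l * cnj (Jnat m (e j) l)"] row [OF em em]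
    by (simp add: inj m_def [symmetric])
  then show "\<epsilon> ** cadjoint \<epsilon> = mat 1"
    by (simp add: eps vec_eq_iff matrix_matrix_mult_def cadjoint_def mat_def m_def)
qed

lemma admissible_eps_matching_involution: "admissible_eps \<epsilon> \<Longrightarrow> matching_involution \<epsilon>"
  unfolding admissible_eps_def matching_involution_def
  using is_J_unitary is_J_transpose by auto

lemma continuous_on_vector2:
  assumes "continuous_on S f" "continuous_on S g"
  shows "continuous_on S (\<lambda>x. vector [f x, g x] :: real^2)"
proof -
  have "(vector [a, b] :: real^2) = (\<chi> i. if i = 1 then a else b)" for a b
    by (simp add: vec_eq_iff forall_2)
  moreover have "continuous_on S (\<lambda>x. if i = 1 then f x else g x)" for i :: 2
    using assms by (cases "i = 1") auto
  ultimately show ?thesis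
    by (simp add: continuous_on_vec_lambda)
qed

lemma vector2_add: "(vector [a + c, b + d] :: real^2) = vector [a, b] + vector [c, d]"
  by (simp add: vec_eq_iff forall_2)

lemma vector2_minus: "(vector [-a, -b] :: real^2) = - vector [a, b]"
  by (simp add: vec_eq_iff forall_2)

lemma matching_family_periodic:
  assumes "matching_family \<epsilon> \<alpha>" "\<And>i. v $ i \<in> \<int>"
  shows "\<alpha> (k + v) = \<alpha> k"
  using assms by (auto simp: matching_family_def)

context matching_involution
begin

lemma sigma_iff: "\<epsilon> ** A = transpose B ** \<epsilon> \<longleftrightarrow> A = \<sigma> B"
proof
  assume "\<epsilon> ** A = transpose B ** \<epsilon>"
  then have "cadjoint \<epsilon> ** (\<epsilon> ** A) = \<sigma> B"
    by (simp add: \<sigma>_def matrix_mul_assoc)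
  then show "A = \<sigma> B"
    by (simp add: matrix_mul_assoc eps_cancel)
next
  assume "A = \<sigma> B"
  then have "\<epsilon> ** A = \<epsilon> ** cadjoint \<epsilon> ** transpose B ** \<epsilon>"
    by (simp add: \<sigma>_def matrix_mul_assoc)
  then show "\<epsilon> ** A = transpose B ** \<epsilon>"
    by (simp add: eps_cancel)
qed

lemma matching_family_iff:
  "matching_family \<epsilon> \<alpha> \<longleftrightarrow> continuous_on UNIV \<alpha> \<and> (\<forall>k. unitary_mat (\<alpha> k)) \<and>
     (\<forall>k v. (\<forall>i. v $ i \<in> \<int>) \<longrightarrow> \<alpha> (k + v) = \<alpha> k) \<and> (\<forall>k. \<alpha> (- k) = \<sigma> (\<alpha> k))"
  unfolding matching_family_def sigma_iff
  by (metis minus_minus)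

lemma matching_family_Fix:
  assumes "matching_family \<epsilon> \<alpha>" "\<And>i. 2 * k $ i \<in> \<int>"
  shows "\<alpha> k \<in> Fix"
proof -
  have "\<alpha> (- k + 2 *\<^sub>R k) = \<alpha> (- k)"
    using assms by (intro matching_family_periodic) auto
  moreover have "- k + 2 *\<^sub>R k = k"
    by (simp add: scaleR_2)
  ultimately show ?thesis
    using assms(1) by (auto simp: matching_family_iff Fix_def)
qed

lemma matching_family_lines:
  assumes "matching_family \<epsilon> \<alpha>" "2 * c \<in> \<int>"
  shows "matching_family \<epsilon> (restr1 \<alpha> c)" "matching_family \<epsilon> (restr2 \<alpha> c)"
proof -
  have cont: "continuous_on UNIV \<alpha>" and uni: "\<And>k. unitary_mat (\<alpha> k)"
    and per: "\<And>k v. (\<forall>i. v $ i \<in> \<int>) \<Longrightarrow> \<alpha> (k + v) = \<alpha> k" and sym: "\<And>k. \<alpha> (- k) = \<sigma> (\<alpha> k)"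
    using assms(1) by (auto simp: matching_family_iff)
  have neg: "\<alpha> (vector [c, - b]) = \<sigma> (\<alpha> (vector [c, b]))" "\<alpha> (vector [- b, c]) = \<sigma> (\<alpha> (vector [b, c]))" for b
  proof -
    have "vector [c, - b] = - vector [c, b] + (vector [2 * c, 0] :: real^2)"
      "vector [- b, c] = - vector [b, c] + (vector [0, 2 * c] :: real^2)"
      by (simp_all add: vec_eq_iff forall_2)
    moreover have "\<forall>i. (vector [2 * c, 0] :: real^2) $ i \<in> \<int>" "\<forall>i. (vector [0, 2 * c] :: real^2) $ i \<in> \<int>"
      using assms(2) by (simp_all add: forall_2)
    ultimately show "\<alpha> (vector [c, - b]) = \<sigma> (\<alpha> (vector [c, b]))" "\<alpha> (vector [- b, c]) = \<sigma> (\<alpha> (vector [b, c]))"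
      using per sym by metis+
  qed
  have shift: "\<alpha> (vector [c, a + b]) = \<alpha> (vector [c, a])" "\<alpha> (vector [a + b, c]) = \<alpha> (vector [a, c])"
    if "b \<in> \<int>" for a b
  proof -
    have "vector [c, a + b] = vector [c, a] + (vector [0, b] :: real^2)"
      "vector [a + b, c] = vector [a, c] + (vector [b, 0] :: real^2)"
      by (simp_all add: vec_eq_iff forall_2)
    moreover have "\<forall>i. (vector [0, b] :: real^2) $ i \<in> \<int>" "\<forall>i. (vector [b, 0] :: real^2) $ i \<in> \<int>"
      using that by (simp_all add: forall_2)
    ultimately show "\<alpha> (vector [c, a + b]) = \<alpha> (vector [c, a])" "\<alpha> (vector [a + b, c]) = \<alpha> (vector [a, c])"
      using per by metis+
  qed
  have "continuous_on UNIV (\<lambda>k::real^1. \<alpha> (vector [c, k $ 1]))"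
    "continuous_on UNIV (\<lambda>k::real^1. \<alpha> (vector [k $ 1, c]))"
    by (rule continuous_on_compose2 [OF cont]; auto intro!: continuous_on_vector2 continuous_intros)+
  then show "matching_family \<epsilon> (restr1 \<alpha> c)" "matching_family \<epsilon> (restr2 \<alpha> c)"
    using uni neg shift by (auto simp: matching_family_iff restr1_def restr2_def)
qed

lemma equiv_homotopic_lines:
  assumes "equiv_homotopic \<epsilon> \<alpha>0 \<alpha>1" "2 * c \<in> \<int>"
  shows "equiv_homotopic \<epsilon> (restr1 \<alpha>0 c) (restr1 \<alpha>1 c)" "equiv_homotopic \<epsilon> (restr2 \<alpha>0 c) (restr2 \<alpha>1 c)"
proof -
  obtain h where h: "continuous_on ({0..1::real} \<times> UNIV) h" "\<And>k. h (0, k) = \<alpha>0 k" "\<And>k. h (1, k) = \<alpha>1 k"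
      "\<And>t. t \<in> {0..1} \<Longrightarrow> matching_family \<epsilon> (\<lambda>k. h (t, k))"
    using assms(1) unfolding equiv_homotopic_iff by blast
  have lines: "matching_family \<epsilon> (\<lambda>k :: real^1. h (t, vector [c, k $ 1]))"
    "matching_family \<epsilon> (\<lambda>k :: real^1. h (t, vector [k $ 1, c]))"
    if "t \<in> {0..1}" for t
    using matching_family_lines [OF h(4) [OF that] assms(2)] by (simp_all add: restr1_def restr2_def)
  have "continuous_on ({0..1} \<times> UNIV) (\<lambda>p :: real \<times> (real^1). h (fst p, vector [c, snd p $ 1]))"
    "continuous_on ({0..1} \<times> UNIV) (\<lambda>p :: real \<times> (real^1). h (fst p, vector [snd p $ 1, c]))"
    by (rule continuous_on_compose2 [OF h(1)]; auto intro!: continuous_on_vector2 continuous_intros)+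
  note cont = this
  show "equiv_homotopic \<epsilon> (restr1 \<alpha>0 c) (restr1 \<alpha>1 c)"
    unfolding equiv_homotopic_iff
    by (rule exI [of _ "\<lambda>p. h (fst p, vector [c, snd p $ 1])"]) (simp add: restr1_def cont h(2,3) lines)
  show "equiv_homotopic \<epsilon> (restr2 \<alpha>0 c) (restr2 \<alpha>1 c)"
    unfolding equiv_homotopic_iff
    by (rule exI [of _ "\<lambda>p. h (fst p, vector [snd p $ 1, c])"]) (simp add: restr2_def cont h(2,3) lines)
qed

sublocale ucover_involution "\<lambda>z. (\<sigma> (fst z), snd z)"
proof
  show "continuous_on ucover (\<lambda>z::(complex^'n^'n) \<times> real. (\<sigma> (fst z), snd z))"
    by (intro continuous_intros)
  fix z :: "(complex^'n^'n) \<times> real"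
  show "z \<in> ucover \<Longrightarrow> (\<sigma> (fst z), snd z) \<in> ucover"
    by (auto simp: ucover_def unitary_sigma det_sigma)
  show "(\<sigma> (fst (\<sigma> (fst z), snd z)), snd (\<sigma> (fst z), snd z)) = z"
    by (simp add: sigma_sigma)
qed

lemma equivariant_lift:
  fixes \<alpha> :: "real^2 \<Rightarrow> complex^'n^'n"
  assumes "matching_family \<epsilon> \<alpha>"
  obtains \<theta> :: "real \<times> real \<Rightarrow> real" where "continuous_on UNIV \<theta>"
    "\<And>a b. det (\<alpha> (vector [a, b])) = cis (\<theta> (a, b))"
    "\<And>d. cis d = 1 \<Longrightarrow> equivariant_map (\<lambda>(a, b). (\<alpha> (vector [a, b]), \<theta> (a, b) + d))"
proof -
  let ?A = "\<lambda>p :: real \<times> real. \<alpha> (vector [fst p, snd p])"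
  have cont: "continuous_on UNIV \<alpha>" and uni: "\<And>k. unitary_mat (\<alpha> k)"
    and per: "\<And>k v. (\<forall>i. v $ i \<in> \<int>) \<Longrightarrow> \<alpha> (k + v) = \<alpha> k" and sym: "\<And>k. \<alpha> (- k) = \<sigma> (\<alpha> k)"
    using assms by (auto simp: matching_family_iff)
  have "continuous_on UNIV (\<lambda>p :: real \<times> real. vector [fst p, snd p] :: real^2)"
    by (intro continuous_on_vector2 continuous_intros)
  then have contA: "continuous_on UNIV ?A"
    by (rule continuous_on_compose2 [OF cont]) auto
  have "continuous_on UNIV (\<lambda>p. det (?A p))"
    by (intro continuous_intros contA)
  then obtain \<theta> where \<theta>: "continuous_on UNIV \<theta>" "\<And>p. det (?A p) = cis (\<theta> p)"
    using cis_lift [of UNIV "\<lambda>p. det (?A p)"] norm_det_unitary [OF uni] by auto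
  have const_diff: "\<theta> (f p) - \<theta> p = \<theta> (f q) - \<theta> q"
    if "continuous_on UNIV f" "\<And>p. det (?A (f p)) = det (?A p)" for f p q
  proof -
    have "continuous_on UNIV (\<lambda>p. \<theta> (f p) - \<theta> p)"
      by (intro continuous_intros \<theta>(1) continuous_on_compose2 [OF \<theta>(1) that(1)]) auto
    moreover have "cis (\<theta> (f p) - \<theta> p) = 1" for p
      using that(2) [of p] \<theta>(2) by (simp add: cis_divide [symmetric])
    ultimately have "(\<lambda>p. \<theta> (f p) - \<theta> p) constant_on UNIV"
      by (intro cis_eq_1_imp_constant) auto
    then show ?thesis
      unfolding constant_on_def by (metis UNIV_I)
  qed
  have even: "\<theta> (- p) = \<theta> p" for p
  proof -
    have "det (?A (- p)) = det (?A p)" for p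
      by (simp add: vector2_minus sym det_sigma)
    then have "\<theta> (- p) - \<theta> p = \<theta> (- 0) - \<theta> 0"
      by (intro const_diff) (auto intro: continuous_intros)
    then show ?thesis
      by simp
  qed
  have perA: "?A (p + (of_int m, of_int n)) = ?A p" for p and m n :: int
  proof -
    have "\<forall>i. (vector [of_int m, of_int n] :: real^2) $ i \<in> \<int>"
      by (simp add: forall_2)
    then show ?thesis
      by (simp add: vector2_add per)
  qed
  have per\<theta>: "\<theta> (p + (of_int m, of_int n)) = \<theta> p" for p and m n :: int
  proof -
    let ?q = "(- of_int m / 2, - of_int n / 2) :: real \<times> real"
    have "\<theta> (p + (of_int m, of_int n)) - \<theta> p = \<theta> (?q + (of_int m, of_int n)) - \<theta> ?q"
      using perA by (intro const_diff) (auto intro!: continuous_intros)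
    moreover have "?q + (of_int m, of_int n) = - ?q"
      by simp
    ultimately show ?thesis
      using even [of ?q] by simp
  qed
  show ?thesis
  proof (rule that [OF \<theta>(1)])
    show "det (\<alpha> (vector [a, b])) = cis (\<theta> (a, b))" for a b
      using \<theta>(2) [of "(a, b)"] by simp
    fix d :: real
    assume d: "cis d = 1"
    have "(\<lambda>(a, b). (\<alpha> (vector [a, b]), \<theta> (a, b) + d)) = (\<lambda>p. (?A p, \<theta> p + d))"
      by auto
    moreover have "equivariant_map (\<lambda>p. (?A p, \<theta> p + d))"
      unfolding equivariant_map_def
    proof (intro conjI allI)
      show "continuous_on UNIV (\<lambda>p. (?A p, \<theta> p + d))"
        by (intro continuous_intros contA \<theta>(1))
      show "range (\<lambda>p. (?A p, \<theta> p + d)) \<subseteq> ucover"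
        using uni \<theta>(2) d by (auto simp: ucover_def cis_mult [symmetric] simp del: cis_mult)
    next
      fix a b :: real
      show "(?A (- a, - b), \<theta> (- a, - b) + d) = (\<sigma> (fst (?A (a, b), \<theta> (a, b) + d)), snd (?A (a, b), \<theta> (a, b) + d))"
        using even [of "(a, b)"] by (simp add: vector2_minus sym)
    next
      fix a b :: real and m n :: int
      show "(?A (a + of_int m, b + of_int n), \<theta> (a + of_int m, b + of_int n) + d) = (?A (a, b), \<theta> (a, b) + d)"
        using perA [of "(a, b)" m n] per\<theta> [of "(a, b)" m n] by simp
    qed
    ultimately show "equivariant_map (\<lambda>(a, b). (\<alpha> (vector [a, b]), \<theta> (a, b) + d))"
      by simp
  qed
qed

text \<open>The determinant of the homotopy lifts to the covering, so its two lifted ends differ from the given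
  lifts by the same multiple of \<open>2 * pi\<close> at all points of the line.\<close>
lemma line_homotopy_common_offset:
  fixes \<beta>0 \<beta>1 :: "real^1 \<Rightarrow> complex^'n^'n"
  assumes "equiv_homotopic \<epsilon> \<beta>0 \<beta>1"
    and "continuous_on UNIV \<theta>0" "continuous_on UNIV \<theta>1"
    and "\<And>c. det (\<beta>0 (vec c)) = cis (\<theta>0 c)" "\<And>c. det (\<beta>1 (vec c)) = cis (\<theta>1 c)"
  obtains d where "\<And>c. c \<in> {0, 1/2} \<Longrightarrow> path_component FixCover (\<beta>0 (vec c), \<theta>0 c) (\<beta>1 (vec c), \<theta>1 c + d)"
proof -
  obtain h where h: "continuous_on ({0..1::real} \<times> UNIV) h" "\<And>k. h (0, k) = \<beta>0 k" "\<And>k. h (1, k) = \<beta>1 k"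
      "\<And>t. t \<in> {0..1} \<Longrightarrow> matching_family \<epsilon> (\<lambda>k. h (t, k))"
    using assms(1) unfolding equiv_homotopic_iff by blast
  have uni: "unitary_mat (h (t, k))" if "t \<in> {0..1}" for t k
    using h(4) [OF that] by (simp add: matching_family_iff)
  have contvec: "continuous_on UNIV (\<lambda>c. vec c :: real^1)"
    unfolding vec_def by (intro continuous_on_vec_lambda continuous_intros)
  let ?S = "{0..1::real} \<times> (UNIV :: real set)"
  have "continuous_on ?S (\<lambda>p. vec (snd p) :: real^1)"
    by (rule continuous_on_compose2 [OF contvec]) (auto intro: continuous_intros)
  then have conth: "continuous_on ?S (\<lambda>p. h (fst p, vec (snd p)))"
    by (intro continuous_on_compose2 [OF h(1)] continuous_intros) auto
  have "continuous_on ?S (\<lambda>p. det (h (fst p, vec (snd p))))"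
    by (intro continuous_intros conth)
  moreover have "norm (det (h (fst p, vec (snd p)))) = 1" if "p \<in> ?S" for p
    using that by (auto intro!: norm_det_unitary uni)
  moreover have "convex ?S"
    by (intro convex_Times) auto
  ultimately obtain \<theta> where \<theta>: "continuous_on ?S \<theta>" "\<And>p. p \<in> ?S \<Longrightarrow> det (h (fst p, vec (snd p))) = cis (\<theta> p)"
    using cis_lift [of ?S "\<lambda>p. det (h (fst p, vec (snd p)))"] by blast
  have offset: "\<exists>e. \<forall>c. \<theta> (t, c) = \<phi> c + e"
    if "t \<in> {0..1}" "continuous_on UNIV \<phi>" "\<And>c. det (h (t, vec c)) = cis (\<phi> c)" for t \<phi>
  proof -
    have "continuous_on UNIV (\<lambda>c. \<theta> (t, c) - \<phi> c)"
      by (intro continuous_intros that(2) continuous_on_compose2 [OF \<theta>(1)]) (use that(1) in auto)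
    moreover have "cis (\<theta> (t, c) - \<phi> c) = 1" for c
      using \<theta>(2) [of "(t, c)"] that by (simp add: cis_divide [symmetric])
    ultimately have "(\<lambda>c. \<theta> (t, c) - \<phi> c) constant_on UNIV"
      by (intro cis_eq_1_imp_constant) auto
    then obtain e where "\<And>c. \<theta> (t, c) - \<phi> c = e"
      unfolding constant_on_def by blast
    then show ?thesis
      by (metis add.commute diff_add_cancel)
  qed
  obtain e0 where e0: "\<And>c. \<theta> (0, c) = \<theta>0 c + e0"
    using offset [of 0 \<theta>0] assms(2,4) h(2) by auto
  obtain e1 where e1: "\<And>c. \<theta> (1, c) = \<theta>1 c + e1"
    using offset [of 1 \<theta>1] assms(3,5) h(3) by auto
  have "cis (\<theta>0 0) = cis (\<theta>0 0 + e0)"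
    using \<theta>(2) [of "(0, 0)"] e0 [of 0] h(2) assms(4) [of 0] by simp
  then have "cis e0 = 1"
    by (simp add: cis_mult [symmetric])
  then have cis_e0: "cis (x - e0) = cis x" for x
    by (simp add: cis_divide [symmetric])
  show ?thesis
  proof (rule that [of "e1 - e0"])
    fix c :: real
    assume c: "c \<in> {0, 1/2}"
    have "2 * c = 0 \<or> 2 * c = 1"
      using c by auto
    then have c2: "2 * c \<in> \<int>"
      by (metis Ints_0 Ints_1)
    let ?g = "\<lambda>t. (h (t, vec c), \<theta> (t, c) - e0)"
    have "path ?g"
      unfolding path_def
      by (intro continuous_intros continuous_on_compose2 [OF h(1)] continuous_on_compose2 [OF \<theta>(1)]) auto
    moreover have "?g t \<in> FixCover" if "t \<in> {0..1}" for t
    proof -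
      have "h (t, vec c) \<in> Fix"
        by (rule matching_family_Fix [OF h(4) [OF that]]) (simp add: c2)
      then show ?thesis
        using \<theta>(2) [of "(t, c)"] that by (simp add: FixCover_def cis_e0)
    qed
    ultimately show "path_component FixCover (\<beta>0 (vec c), \<theta>0 c) (\<beta>1 (vec c), \<theta>1 c + (e1 - e0))"
      unfolding path_component_def
      by (intro exI [of _ ?g]) (auto simp: path_image_def pathstart_def pathfinish_def h(2,3) e0 e1)
  qed
qed

lemma equiv_homotopic_of_lines:
  fixes \<alpha>0 \<alpha>1 :: "real^2 \<Rightarrow> complex^'n^'n"
  assumes \<alpha>0: "matching_family \<epsilon> \<alpha>0" and \<alpha>1: "matching_family \<epsilon> \<alpha>1"
    and left: "equiv_homotopic \<epsilon> (restr1 \<alpha>0 0) (restr1 \<alpha>1 0)"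
    and right: "equiv_homotopic \<epsilon> (restr1 \<alpha>0 (1/2)) (restr1 \<alpha>1 (1/2))"
    and bottom: "equiv_homotopic \<epsilon> (restr2 \<alpha>0 0) (restr2 \<alpha>1 0)"
  shows "equiv_homotopic \<epsilon> \<alpha>0 \<alpha>1"
proof -
  let ?v = "\<lambda>a b. vector [a, b] :: real^2"
  obtain \<theta>0 where \<theta>0: "continuous_on UNIV \<theta>0" "\<And>a b. det (\<alpha>0 (?v a b)) = cis (\<theta>0 (a, b))"
    and eq0: "\<And>d. cis d = 1 \<Longrightarrow> equivariant_map (\<lambda>(a, b). (\<alpha>0 (?v a b), \<theta>0 (a, b) + d))"
    using equivariant_lift [OF \<alpha>0] by blast
  obtain \<theta>1 where \<theta>1: "continuous_on UNIV \<theta>1" "\<And>a b. det (\<alpha>1 (?v a b)) = cis (\<theta>1 (a, b))"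
    and eq1: "\<And>d. cis d = 1 \<Longrightarrow> equivariant_map (\<lambda>(a, b). (\<alpha>1 (?v a b), \<theta>1 (a, b) + d))"
    using equivariant_lift [OF \<alpha>1] by blast
  define P where "P a b d \<longleftrightarrow> path_component FixCover (\<alpha>0 (?v a b), \<theta>0 (a, b)) (\<alpha>1 (?v a b), \<theta>1 (a, b) + d)"
    for a b d
  have slice: "continuous_on UNIV (\<lambda>c. \<theta> (a, c))" "continuous_on UNIV (\<lambda>c. \<theta> (c, a))"
    if "continuous_on UNIV \<theta>" for \<theta> :: "real \<times> real \<Rightarrow> real" and a
    by (rule continuous_on_compose2 [OF that]; auto intro!: continuous_intros)+
  have vertical: "\<exists>d. \<forall>b\<in>{0, 1/2}. P a b d" if hom: "equiv_homotopic \<epsilon> (restr1 \<alpha>0 a) (restr1 \<alpha>1 a)" for a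
  proof -
    have "det (restr1 \<alpha>0 a (vec c)) = cis (\<theta>0 (a, c))" "det (restr1 \<alpha>1 a (vec c)) = cis (\<theta>1 (a, c))" for c
      by (simp_all add: restr1_def \<theta>0(2) \<theta>1(2))
    from line_homotopy_common_offset [OF hom slice(1) [OF \<theta>0(1)] slice(1) [OF \<theta>1(1)] this]
    obtain d where "\<And>c. c \<in> {0, 1/2} \<Longrightarrow> path_component FixCover
        (restr1 \<alpha>0 a (vec c), \<theta>0 (a, c)) (restr1 \<alpha>1 a (vec c), \<theta>1 (a, c) + d)"
      by blast
    then show ?thesis
      by (intro exI [of _ d]) (simp add: P_def restr1_def)
  qed
  have horizontal: "\<exists>d. \<forall>a\<in>{0, 1/2}. P a b d" if hom: "equiv_homotopic \<epsilon> (restr2 \<alpha>0 b) (restr2 \<alpha>1 b)" for b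
  proof -
    have "det (restr2 \<alpha>0 b (vec c)) = cis (\<theta>0 (c, b))" "det (restr2 \<alpha>1 b (vec c)) = cis (\<theta>1 (c, b))" for c
      by (simp_all add: restr2_def \<theta>0(2) \<theta>1(2))
    from line_homotopy_common_offset [OF hom slice(2) [OF \<theta>0(1)] slice(2) [OF \<theta>1(1)] this]
    obtain d where "\<And>c. c \<in> {0, 1/2} \<Longrightarrow> path_component FixCover
        (restr2 \<alpha>0 b (vec c), \<theta>0 (c, b)) (restr2 \<alpha>1 b (vec c), \<theta>1 (c, b) + d)"
      by blast
    then show ?thesis
      by (intro exI [of _ d]) (simp add: P_def restr2_def)
  qed
  have transfer: "P a' b' d'" if "P a b d" "P a b d'" "P a' b' d" for a b a' b' d d'
    using path_component_FixCover_transfer that \<theta>1(2) unfolding P_def by blast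
  obtain d1 where d1: "P 0 0 d1" "P 0 (1/2) d1"
    using vertical [OF left] by blast
  obtain d3 where d3: "P (1/2) 0 d3" "P (1/2) (1/2) d3"
    using vertical [OF right] by blast
  obtain d where d: "P 0 0 d" "P (1/2) 0 d"
    using horizontal [OF bottom] by blast
  have P: "P a b d" if "a \<in> {0, 1/2}" "b \<in> {0, 1/2}" for a b
    using that d transfer [OF d1(1) d(1) d1(2)] transfer [OF d3(1) d(2) d3(2)] by blast
  have "cis (\<theta>1 (0, 0) + d) = cis (\<theta>1 (0, 0))"
    using path_component_FixCover_mem(4) [OF d(1) [unfolded P_def]] \<theta>1(2) [of 0 0] by simp
  then have cis_d: "cis d = 1"
    by (simp add: cis_mult [symmetric])
  let ?x0 = "\<lambda>(a, b). (\<alpha>0 (?v a b), \<theta>0 (a, b) + 0)" and ?x1 = "\<lambda>(a, b). (\<alpha>1 (?v a b), \<theta>1 (a, b) + d)"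
  have corners: "\<exists>c. continuous_on {0..1::real} c \<and>
      (\<forall>t\<in>{0..1}. c t \<in> ucover \<and> (\<sigma> (fst (c t)), snd (c t)) = c t) \<and> c 0 = ?x0 (a, b) \<and> c 1 = ?x1 (a, b)"
    if "a \<in> {0, 1/2}" "b \<in> {0, 1/2}" for a b
  proof -
    have "P a b d"
      using that by (rule P)
    then obtain c where c: "path c" "path_image c \<subseteq> FixCover"
        "pathstart c = (\<alpha>0 (?v a b), \<theta>0 (a, b))" "pathfinish c = (\<alpha>1 (?v a b), \<theta>1 (a, b) + d)"
      unfolding P_def path_component_def by blast
    have "c t \<in> ucover \<and> (\<sigma> (fst (c t)), snd (c t)) = c t" if "t \<in> {0..1}" for t
    proof -
      have "c t \<in> FixCover"
        using c(2) that by (auto simp: path_image_def)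
      then show ?thesis
        by (auto simp: FixCover_def Fix_def ucover_def)
    qed
    then show ?thesis
      using c by (intro exI [of _ c]) (auto simp: path_def pathstart_def pathfinish_def)
  qed
  obtain H :: "real \<times> real \<times> real \<Rightarrow> (complex^'n^'n) \<times> real" where
    H: "continuous_on ({0..1} \<times> UNIV) H" "\<And>t. t \<in> {0..1} \<Longrightarrow> equivariant_map (\<lambda>p. H (t, p))"
      "\<And>p. H (0, p) = ?x0 p" "\<And>p. H (1, p) = ?x1 p"
    by (rule equivariant_homotopy_extension [OF eq0 [of 0] eq1 [OF cis_d] corners]) auto
  define h where "h p = fst (H (fst p, snd p $ 1, snd p $ 2))" for p :: "real \<times> (real^2)"
  have eta: "?v (k $ 1) (k $ 2) = k" for k
    by (simp add: vec_eq_iff forall_2)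
  have "continuous_on ({0..1} \<times> UNIV) (\<lambda>p :: real \<times> (real^2). H (fst p, snd p $ 1, snd p $ 2))"
    by (rule continuous_on_compose2 [OF H(1)]) (auto intro!: continuous_intros)
  then have conth: "continuous_on ({0..1} \<times> UNIV) h"
    unfolding h_def by (rule continuous_on_fst)
  moreover have "matching_family \<epsilon> (\<lambda>k. h (t, k))" if t: "t \<in> {0..1}" for t
    unfolding matching_family_iff
  proof (intro conjI allI impI)
    have E: "range (\<lambda>p. H (t, p)) \<subseteq> ucover" "\<And>a b. H (t, - a, - b) = (\<sigma> (fst (H (t, a, b))), snd (H (t, a, b)))"
      "\<And>a b (m::int) (n::int). H (t, a + of_int m, b + of_int n) = H (t, a, b)"
      using H(2) [OF t] unfolding equivariant_map_def by auto
    show "continuous_on UNIV (\<lambda>k. h (t, k))"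
      by (rule continuous_on_compose2 [OF conth]) (use t in \<open>auto intro!: continuous_intros\<close>)
    fix k :: "real^2"
    have "H (t, k $ 1, k $ 2) \<in> ucover"
      using E(1) by blast
    then show "unitary_mat (h (t, k))"
      by (auto simp: h_def ucover_def)
    show "h (t, - k) = \<sigma> (h (t, k))"
      by (simp add: h_def E(2))
    fix v :: "real^2"
    assume "\<forall>i. v $ i \<in> \<int>"
    then obtain m n :: int where "v $ 1 = of_int m" "v $ 2 = of_int n"
      by (metis Ints_cases)
    then show "h (t, k + v) = h (t, k)"
      by (simp add: h_def E(3))
  qed
  moreover have "h (0, k) = \<alpha>0 k" "h (1, k) = \<alpha>1 k" for k
    by (simp_all add: h_def H(3,4) eta)
  ultimately show ?thesis
    unfolding equiv_homotopic_iff by blast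
qed

end

theorem theorem2p10:
  fixes \<epsilon> :: "complex^'n^'n"
    and \<alpha>0 \<alpha>1 :: "real^2 \<Rightarrow> complex^'n^'n"
  assumes "admissible_eps \<epsilon>"
    and "matching_family \<epsilon> \<alpha>0"
    and "matching_family \<epsilon> \<alpha>1"
  shows "equiv_homotopic \<epsilon> \<alpha>0 \<alpha>1 \<longleftrightarrow>
           (equiv_homotopic \<epsilon> (restr1 \<alpha>0 0) (restr1 \<alpha>1 0) \<and>
            equiv_homotopic \<epsilon> (restr1 \<alpha>0 (1/2)) (restr1 \<alpha>1 (1/2)) \<and>
            equiv_homotopic \<epsilon> (restr2 \<alpha>0 0) (restr2 \<alpha>1 0) \<and>
            equiv_homotopic \<epsilon> (restr2 \<alpha>0 (1/2)) (restr2 \<alpha>1 (1/2)))"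
proof -
  interpret matching_involution \<epsilon>
    using assms(1) by (rule admissible_eps_matching_involution)
  have "2 * 0 \<in> (\<int> :: real set)" "2 * (1/2) \<in> (\<int> :: real set)"
    by simp_all
  then show ?thesis
    using equiv_homotopic_of_lines [OF assms(2,3)] equiv_homotopic_lines by blast
qed

end
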